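(* Let $1\le p<\infty$ and suppose that $\{x_n\}_{n=1}^\infty$ is a normalized unconditionally basic sequence of non-negative functions in $L_p=L_p(0,\infty)$. Then $\{x_n\}_{n=1}^\infty$ is equivalent to the unit vector basis of $\ell_p$; that is, there are constants $0<c\le C<\infty$ such that for all $N$ and all scalars $a_1,\dots,a_N$, $$c\Big(\sum_{n=1}^N|a_n|^p\Big)^{1/p}\le \Big\|\sum_{n=1}^N a_nx_n\Big\|_p\le C\Big(\sum_{n=1}^N|a_n|^p\Big)^{1/p}.$$
   Context: $L_p(0,\infty)$ is taken with respect to Lebesgue measure. Non-negative means non-negative almost everywhere. Normalized means $\|x_n\|_p=1$ for all $n$. A sequence is unconditionally basic if it is a Schauder basis of its closed linear span such that, for every element of the span, its basis expansion converges unconditionally. *)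

theory Defs
  imports "HOL-Analysis.Analysis"
begin

text \<open>
  Elements of \<open>L\<^sub>p(M)\<close> are represented by real functions, not by almost-everywhere classes;
  \<open>Lp_norm\<close> is therefore a seminorm on \<open>Lp_space\<close>, and limits are unique up to null sets.
\<close>

definition Lp_space :: "'a measure \<Rightarrow> real \<Rightarrow> ('a \<Rightarrow> real) set" where
  "Lp_space M p =
    {f. f \<in> borel_measurable M \<and> integrable M (\<lambda>t. \<bar>f t\<bar> powr p)}"

definition Lp_norm :: "'a measure \<Rightarrow> real \<Rightarrow> ('a \<Rightarrow> real) \<Rightarrow> real" where
  "Lp_norm M p f = (integral\<^sup>L M (\<lambda>t. \<bar>f t\<bar> powr p)) powr (1 / p)"

text \<open>
  Membership in \<open>Lp_space\<close> is demanded explicitly because \<open>Lp_norm\<close> takes the value \<open>0\<close> on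
  functions whose \<open>p\<close>-th power is not integrable.
\<close>

definition Lp_sums ::
    "'a measure \<Rightarrow> real \<Rightarrow> (nat \<Rightarrow> 'a \<Rightarrow> real) \<Rightarrow> ('a \<Rightarrow> real) \<Rightarrow> bool" where
  "Lp_sums M p y f \<longleftrightarrow>
    (\<forall>n. y n \<in> Lp_space M p) \<and> f \<in> Lp_space M p \<and>
    (\<lambda>N. Lp_norm M p (\<lambda>t. f t - (\<Sum>n<N. y n t))) \<longlonglongrightarrow> 0"

definition Lp_unconditionally_summable ::
    "'a measure \<Rightarrow> real \<Rightarrow> (nat \<Rightarrow> 'a \<Rightarrow> real) \<Rightarrow> bool" where
  "Lp_unconditionally_summable M p y \<longleftrightarrow>
    (\<forall>\<pi>. bij \<pi> \<longrightarrow> (\<exists>g. Lp_sums M p (\<lambda>n. y (\<pi> n)) g))"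

definition Lp_closed_span ::
    "'a measure \<Rightarrow> real \<Rightarrow> (nat \<Rightarrow> 'a \<Rightarrow> real) \<Rightarrow> ('a \<Rightarrow> real) set" where
  "Lp_closed_span M p x =
    {f \<in> Lp_space M p. \<forall>e>0. \<exists>N a. Lp_norm M p (\<lambda>t. f t - (\<Sum>n<N. a n * x n t)) < e}"

definition Lp_schauder_basis ::
    "'a measure \<Rightarrow> real \<Rightarrow> (nat \<Rightarrow> 'a \<Rightarrow> real) \<Rightarrow> ('a \<Rightarrow> real) set \<Rightarrow> bool" where
  "Lp_schauder_basis M p x V \<longleftrightarrow>
    (\<forall>n. x n \<in> V) \<and> (\<forall>f\<in>V. \<exists>!a. Lp_sums M p (\<lambda>n t. a n * x n t) f)"

definition Lp_unconditionally_basic ::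
    "'a measure \<Rightarrow> real \<Rightarrow> (nat \<Rightarrow> 'a \<Rightarrow> real) \<Rightarrow> bool" where
  "Lp_unconditionally_basic M p x \<longleftrightarrow>
    (\<forall>n. x n \<in> Lp_space M p) \<and>
    Lp_schauder_basis M p x (Lp_closed_span M p x) \<and>
    (\<forall>f\<in>Lp_closed_span M p x. \<forall>a. Lp_sums M p (\<lambda>n t. a n * x n t) f \<longrightarrow>
       Lp_unconditionally_summable M p (\<lambda>n t. a n * x n t))"

end

theory Submission
  imports Defs
begin

text \<open>
  Write \<open>A\<^sub>r(a) = \<parallel>(\<Sum> \<bar>a n x n\<bar>\<^sup>r)\<^sup>1\<^sup>/\<^sup>r\<parallel>\<^sub>p\<close>. Since \<open>\<parallel>x n\<parallel>\<^sub>p = 1\<close>, the quantity \<open>A\<^sub>p(a)\<close> is exactly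
  the \<open>\<ell>\<^sub>p\<close>-norm of \<open>a\<close>, so both estimates compare \<open>\<parallel>\<Sum> a n x n\<parallel>\<^sub>p\<close> with \<open>A\<^sub>p(a)\<close>.

  Positivity enters through unconditionality. If \<open>\<Sum> c n x n\<close> converges unconditionally, then so do
  the subseries of its positive and of its negative coefficients; as \<open>x n \<ge> 0\<close>, this means that
  \<open>\<Sum> \<bar>c n x n\<bar>\<close> is bounded in \<open>L\<^sub>p\<close> (\<open>unconditionally_summable_abs_bounded\<close>). The lattice norm
  \<open>sup\<^sub>N \<parallel>\<Sum>\<^sub>n\<^sub><\<^sub>N \<bar>c n x n\<bar>\<parallel>\<^sub>p\<close> of the coefficients is therefore finite on the whole closed span. It is
  countably subadditive there, and Zabreiko's lemma, a form of the open mapping theorem, bounds it by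
  a multiple of \<open>\<parallel>\<cdot>\<parallel>\<^sub>p\<close>: there is \<open>K\<close> with \<open>A\<^sub>1(a) \<le> K \<parallel>\<Sum> \<plusminus>a n x n\<parallel>\<^sub>p\<close> for every choice of signs
  (\<open>unconditional_constant\<close>).

  The lower estimate follows from \<open>A\<^sub>p \<le> A\<^sub>1\<close>. For the upper one, average over the signs: Khintchine's
  inequality turns the bound above into \<open>A\<^sub>1 \<le> K' A\<^sub>2\<close>. Pointwise, with \<open>y n = \<bar>a n x n\<bar>\<close>,
  \<open>\<Sum> (y n)\<^sup>2 \<le> (max y) (\<Sum> y n) \<le> (\<Sum> (y n)\<^sup>p)\<^sup>1\<^sup>/\<^sup>p (\<Sum> y n)\<close>, so by the arithmetic-geometric mean inequality
  the \<open>p\<close>-th power of \<open>A\<^sub>2\<close> is at most a small multiple of that of \<open>A\<^sub>1\<close> plus a large multiple of that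
  of \<open>A\<^sub>p\<close>. The first term is absorbed into the left-hand side, leaving \<open>A\<^sub>1 \<le> K'' A\<^sub>p\<close>
  (\<open>abs_sum_le_lp\<close>); clearly \<open>\<parallel>\<Sum> a n x n\<parallel>\<^sub>p \<le> A\<^sub>1(a)\<close>.
\<close>

section \<open>The seminorm of \<open>L\<^sub>p\<close> and its completeness\<close>

lemma powr_convex_nonneg:
  fixes p u v s :: real
  assumes p: "1 \<le> p" and "0 \<le> u" "0 \<le> v" "0 \<le> s" "s \<le> 1"
  shows "((1 - s) * u + s * v) powr p \<le> (1 - s) * u powr p + s * v powr p"
proof -
  have scale: "(r * w) powr p \<le> r * w powr p" if "0 \<le> r" "r \<le> 1" "0 \<le> w" for r w :: real
  proof (cases "r = 0")
    case False
    then have "r powr p \<le> r powr 1"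
      using that p by (intro powr_mono') auto
    then show ?thesis
      using that False by (simp add: powr_mult mult_right_mono)
  qed simp
  show ?thesis
  proof (cases "u = 0 \<or> v = 0")
    case True
    then show ?thesis
      using scale[of s v] scale[of "1 - s" u] assms by auto
  next
    case False
    then show ?thesis
      using convex_onD[OF powr_convex[OF p], of s u v] assms by simp
  qed
qed

locale Lp_exponent =
  fixes M :: "'a measure" and p :: real
  assumes p: "1 \<le> p"
begin

lemma Lp_norm_nonneg: "0 \<le> Lp_norm M p f"
  by (simp add: Lp_norm_def)

lemma Lp_norm_powr: "Lp_norm M p f powr p = (\<integral>t. \<bar>f t\<bar> powr p \<partial>M)"
  using p by (simp add: Lp_norm_def powr_powr)

lemma Lp_norm_le_iff:
  assumes "0 \<le> a"
  shows "Lp_norm M p f \<le> a \<longleftrightarrow> (\<integral>t. \<bar>f t\<bar> powr p \<partial>M) \<le> a powr p"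
  using p assms Lp_norm_nonneg[of f] unfolding Lp_norm_powr[symmetric]
  by (metis dual_order.strict_trans2 less_le_not_le linorder_not_le powr_less_mono2 powr_mono2
      zero_less_one)

lemma Lp_space_measurable: "f \<in> Lp_space M p \<Longrightarrow> f \<in> borel_measurable M"
  by (simp add: Lp_space_def)

text \<open>
  Passing to the extended integral packs membership in \<open>L\<^sub>p\<close> and the norm bound into one inequality,
  to which domination, Fatou's lemma and monotone convergence apply directly.
\<close>

lemma Lp_space_norm_le_iff_nn_integral:
  assumes f: "f \<in> borel_measurable M" and a: "0 \<le> a"
  shows "f \<in> Lp_space M p \<and> Lp_norm M p f \<le> a \<longleftrightarrow>
    (\<integral>\<^sup>+t. ennreal (\<bar>f t\<bar> powr p) \<partial>M) \<le> ennreal (a powr p)" (is "?L \<longleftrightarrow> ?R")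
proof
  assume ?L
  then show ?R
    by (subst nn_integral_eq_integral) (auto simp: Lp_space_def Lp_norm_le_iff[OF a] ennreal_leI)
next
  assume R: ?R
  have "integrable M (\<lambda>t. \<bar>f t\<bar> powr p)"
    using R f by (intro integrableI_nonneg) (auto simp: le_less_trans[OF R])
  moreover from this have "(\<integral>t. \<bar>f t\<bar> powr p \<partial>M) \<le> a powr p"
    using R by (simp add: nn_integral_eq_integral)
  ultimately show ?L
    using f by (simp add: Lp_space_def Lp_norm_le_iff[OF a])
qed

lemma Lp_dominated:
  assumes f: "f \<in> borel_measurable M" and g: "g \<in> Lp_space M p"
    and le: "AE t in M. \<bar>f t\<bar> \<le> \<bar>g t\<bar>"
  shows "f \<in> Lp_space M p \<and> Lp_norm M p f \<le> Lp_norm M p g"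
proof (subst Lp_space_norm_le_iff_nn_integral[OF f Lp_norm_nonneg])
  have "(\<integral>\<^sup>+t. ennreal (\<bar>f t\<bar> powr p) \<partial>M) \<le> (\<integral>\<^sup>+t. ennreal (\<bar>g t\<bar> powr p) \<partial>M)"
    using le p by (intro nn_integral_mono_AE) (auto intro!: ennreal_leI powr_mono2)
  also have "\<dots> \<le> ennreal (Lp_norm M p g powr p)"
    using Lp_space_norm_le_iff_nn_integral[OF Lp_space_measurable[OF g] Lp_norm_nonneg] g by blast
  finally show "(\<integral>\<^sup>+t. ennreal (\<bar>f t\<bar> powr p) \<partial>M) \<le> ennreal (Lp_norm M p g powr p)" .
qed

lemma Lp_norm_cong_AE:
  assumes "f \<in> borel_measurable M" "g \<in> borel_measurable M" "AE t in M. \<bar>f t\<bar> = \<bar>g t\<bar>"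
  shows "Lp_norm M p f = Lp_norm M p g"
  unfolding Lp_norm_def using assms
  by (intro arg_cong[where f = "\<lambda>s. s powr (1 / p)"] integral_cong_AE) auto

lemma Lp_zero: "(\<lambda>t. 0) \<in> Lp_space M p" "Lp_norm M p (\<lambda>t. 0) = 0"
  by (auto simp: Lp_space_def Lp_norm_def)

lemma Lp_scale:
  assumes "f \<in> Lp_space M p"
  shows "(\<lambda>t. c * f t) \<in> Lp_space M p" "Lp_norm M p (\<lambda>t. c * f t) = \<bar>c\<bar> * Lp_norm M p f"
  using assms p by (auto simp: Lp_space_def Lp_norm_def abs_mult powr_mult powr_powr)

text \<open>
  Minkowski's inequality: for \<open>a > \<parallel>f\<parallel>\<close> and \<open>b > \<parallel>g\<parallel>\<close> convexity of \<open>s\<^sup>p\<close> bounds the \<open>p\<close>-th power of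
  the convex combination \<open>(f + g) / (a + b)\<close> of \<open>f / a\<close> and \<open>g / b\<close>.
\<close>

lemma Lp_add:
  assumes f: "f \<in> Lp_space M p" and g: "g \<in> Lp_space M p"
  shows "(\<lambda>t. f t + g t) \<in> Lp_space M p"
    "Lp_norm M p (\<lambda>t. f t + g t) \<le> Lp_norm M p f + Lp_norm M p g"
proof -
  have meas: "(\<lambda>t. f t + g t) \<in> borel_measurable M"
    using f[THEN Lp_space_measurable] g[THEN Lp_space_measurable] by simp
  have main: "(\<lambda>t. f t + g t) \<in> Lp_space M p \<and> Lp_norm M p (\<lambda>t. f t + g t) \<le> a + b"
    if a: "Lp_norm M p f < a" and b: "Lp_norm M p g < b" for a b
  proof -
    have pos: "0 < a" "0 < b"
      using a b Lp_norm_nonneg[of f] Lp_norm_nonneg[of g] by linarith+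
    define h where "h t = (a + b) powr p *
        (a / (a + b) * (\<bar>f t\<bar> powr p / a powr p) + b / (a + b) * (\<bar>g t\<bar> powr p / b powr p))" for t
    have int: "integrable M (\<lambda>t. \<bar>f t\<bar> powr p)" "integrable M (\<lambda>t. \<bar>g t\<bar> powr p)"
      using f g by (auto simp: Lp_space_def)
    have le: "\<bar>f t + g t\<bar> powr p \<le> h t" for t
    proof -
      have "\<bar>f t + g t\<bar> powr p \<le> (\<bar>f t\<bar> + \<bar>g t\<bar>) powr p"
        using p by (intro powr_mono2) auto
      also have "\<bar>f t\<bar> + \<bar>g t\<bar> = (a + b) *
          ((1 - b / (a + b)) * (\<bar>f t\<bar> / a) + b / (a + b) * (\<bar>g t\<bar> / b))"
        using pos by (simp add: divide_simps)
      also have "\<dots> powr p = (a + b) powr p *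
          ((1 - b / (a + b)) * (\<bar>f t\<bar> / a) + b / (a + b) * (\<bar>g t\<bar> / b)) powr p"
        using pos by (subst powr_mult) (auto simp: field_simps)
      also have "\<dots> \<le> (a + b) powr p *
          ((1 - b / (a + b)) * (\<bar>f t\<bar> / a) powr p + b / (a + b) * (\<bar>g t\<bar> / b) powr p)"
        using pos by (intro mult_left_mono powr_convex_nonneg p) auto
      also have "\<dots> = h t"
        using pos by (simp add: h_def powr_divide diff_divide_eq_iff)
      finally show ?thesis .
    qed
    have "integrable M h"
      using int by (auto simp: h_def[abs_def])
    then have intfg: "integrable M (\<lambda>t. \<bar>f t + g t\<bar> powr p)"
      using meas order_trans[OF le abs_ge_self]
      by (auto elim!: Bochner_Integration.integrable_bound)
    have "(\<integral>t. \<bar>f t + g t\<bar> powr p \<partial>M) \<le> integral\<^sup>L M h"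
      using le by (intro integral_mono intfg \<open>integrable M h\<close>)
    also have "\<dots> = (a + b) powr p * (a / (a + b) * ((\<integral>t. \<bar>f t\<bar> powr p \<partial>M) / a powr p) +
        b / (a + b) * ((\<integral>t. \<bar>g t\<bar> powr p \<partial>M) / b powr p))"
      using int by (simp add: h_def[abs_def])
    also have "\<dots> \<le> (a + b) powr p * (a / (a + b) * 1 + b / (a + b) * 1)"
      using pos a b Lp_norm_le_iff[of a f] Lp_norm_le_iff[of b g]
      by (intro mult_left_mono add_mono) auto
    also have "\<dots> = (a + b) powr p"
      using pos by (simp add: add_divide_distrib[symmetric])
    finally show ?thesis
      using intfg meas pos by (simp add: Lp_norm_le_iff Lp_space_def)
  qed
  show "(\<lambda>t. f t + g t) \<in> Lp_space M p"
    using main[of "Lp_norm M p f + 1" "Lp_norm M p g + 1"] by simp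
  show "Lp_norm M p (\<lambda>t. f t + g t) \<le> Lp_norm M p f + Lp_norm M p g"
  proof (rule field_le_epsilon)
    fix e :: real
    assume "0 < e"
    then show "Lp_norm M p (\<lambda>t. f t + g t) \<le> Lp_norm M p f + Lp_norm M p g + e"
      using main[of "Lp_norm M p f + e / 2" "Lp_norm M p g + e / 2"] by simp
  qed
qed

lemma Lp_add_scaled:
  assumes "f \<in> Lp_space M p" "g \<in> Lp_space M p"
  shows "(\<lambda>t. f t + c * g t) \<in> Lp_space M p"
    "Lp_norm M p (\<lambda>t. f t + c * g t) \<le> Lp_norm M p f + \<bar>c\<bar> * Lp_norm M p g"
  using Lp_add[OF assms(1) Lp_scale(1)[OF assms(2)], of c] Lp_scale(2)[OF assms(2), of c] by auto

lemma Lp_diff: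
  assumes "f \<in> Lp_space M p" "g \<in> Lp_space M p"
  shows "(\<lambda>t. f t - g t) \<in> Lp_space M p"
    "Lp_norm M p (\<lambda>t. f t - g t) \<le> Lp_norm M p f + Lp_norm M p g"
  using Lp_add_scaled[OF assms, of "- 1"] by auto

lemma Lp_abs:
  assumes "f \<in> Lp_space M p"
  shows "(\<lambda>t. \<bar>f t\<bar>) \<in> Lp_space M p" "Lp_norm M p (\<lambda>t. \<bar>f t\<bar>) = Lp_norm M p f"
  using assms by (auto simp: Lp_space_def Lp_norm_def)

lemma Lp_sum:
  assumes "\<And>i. i \<in> I \<Longrightarrow> f i \<in> Lp_space M p"
  shows "(\<lambda>t. \<Sum>i\<in>I. f i t) \<in> Lp_space M p"
    "Lp_norm M p (\<lambda>t. \<Sum>i\<in>I. f i t) \<le> (\<Sum>i\<in>I. Lp_norm M p (f i))"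
proof -
  have "(\<lambda>t. \<Sum>i\<in>I. f i t) \<in> Lp_space M p \<and>
      Lp_norm M p (\<lambda>t. \<Sum>i\<in>I. f i t) \<le> (\<Sum>i\<in>I. Lp_norm M p (f i))"
    using assms
  proof (induction I rule: infinite_finite_induct)
    case (insert i I)
    then have "f i \<in> Lp_space M p" and IH: "(\<lambda>t. \<Sum>i\<in>I. f i t) \<in> Lp_space M p"
        "Lp_norm M p (\<lambda>t. \<Sum>i\<in>I. f i t) \<le> (\<Sum>i\<in>I. Lp_norm M p (f i))"
      by auto
    from Lp_add[OF this(1,2)] this(3) insert.hyps show ?case
      by auto
  qed (auto simp: Lp_zero)
  then show "(\<lambda>t. \<Sum>i\<in>I. f i t) \<in> Lp_space M p"
    "Lp_norm M p (\<lambda>t. \<Sum>i\<in>I. f i t) \<le> (\<Sum>i\<in>I. Lp_norm M p (f i))"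
    by auto
qed

text \<open>
  Fatou's lemma in the form used for limits: norm balls are closed under almost everywhere
  convergence, and the limit belongs to \<open>L\<^sub>p\<close> automatically.
\<close>

lemma Lp_norm_Fatou:
  assumes f: "f \<in> borel_measurable M" and a: "0 \<le> a"
    and u: "\<And>j. u j \<in> Lp_space M p" "\<And>j. Lp_norm M p (u j) \<le> a"
    and lim: "AE t in M. (\<lambda>j. u j t) \<longlonglongrightarrow> f t"
  shows "f \<in> Lp_space M p \<and> Lp_norm M p f \<le> a"
proof (subst Lp_space_norm_le_iff_nn_integral[OF f a])
  have "(\<integral>\<^sup>+t. ennreal (\<bar>f t\<bar> powr p) \<partial>M) = (\<integral>\<^sup>+t. liminf (\<lambda>j. ennreal (\<bar>u j t\<bar> powr p)) \<partial>M)"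
  proof (rule nn_integral_cong_AE, use lim in eventually_elim)
    fix t
    assume "(\<lambda>j. u j t) \<longlonglongrightarrow> f t"
    then have "(\<lambda>j. \<bar>u j t\<bar> powr p) \<longlonglongrightarrow> \<bar>f t\<bar> powr p"
      using p by (intro tendsto_powr' tendsto_rabs) auto
    then have "(\<lambda>j. ennreal (\<bar>u j t\<bar> powr p)) \<longlonglongrightarrow> ennreal (\<bar>f t\<bar> powr p)"
      by simp
    from lim_imp_Liminf[OF _ this]
    show "ennreal (\<bar>f t\<bar> powr p) = liminf (\<lambda>j. ennreal (\<bar>u j t\<bar> powr p))"
      by simp
  qed
  also have "\<dots> \<le> liminf (\<lambda>j. \<integral>\<^sup>+t. ennreal (\<bar>u j t\<bar> powr p) \<partial>M)"
    using u(1)[THEN Lp_space_measurable] by (intro nn_integral_liminf) auto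
  also have "\<dots> \<le> ennreal (a powr p)"
  proof -
    have "(\<integral>\<^sup>+t. ennreal (\<bar>u j t\<bar> powr p) \<partial>M) \<le> ennreal (a powr p)" for j
      using Lp_space_norm_le_iff_nn_integral[OF u(1)[THEN Lp_space_measurable] a] u by blast
    then show ?thesis
      by (intro Liminf_le) auto
  qed
  finally show "(\<integral>\<^sup>+t. ennreal (\<bar>f t\<bar> powr p) \<partial>M) \<le> ennreal (a powr p)" .
qed

text \<open>
  Riesz--Fischer: the partial sums of \<open>\<Sum>\<bar>u k\<bar>\<close> are bounded in \<open>L\<^sub>p\<close>, so by monotone convergence
  their pointwise supremum is finite almost everywhere; the pointwise sum is then the limit, with
  the tail estimate given by Fatou's lemma.
\<close>

lemma Lp_series_converges:
  assumes u: "\<And>k. u k \<in> Lp_space M p" and sum: "summable (\<lambda>k. Lp_norm M p (u k))"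
  obtains f where "f \<in> Lp_space M p"
    "\<And>m. Lp_norm M p (\<lambda>t. f t - (\<Sum>k<m. u k t)) \<le> (\<Sum>k. Lp_norm M p (u (k + m)))"
proof -
  note meas = u[THEN Lp_space_measurable]
  define S where "S = (\<Sum>k. Lp_norm M p (u k))"
  have S0: "0 \<le> S"
    unfolding S_def by (intro suminf_nonneg sum Lp_norm_nonneg)
  define G where "G m t = ennreal ((\<Sum>k<m. \<bar>u k t\<bar>) powr p)" for m t
  have G_bound: "(\<integral>\<^sup>+t. G m t \<partial>M) \<le> ennreal (S powr p)" for m
  proof -
    have "(\<lambda>t. \<Sum>k<m. \<bar>u k t\<bar>) \<in> Lp_space M p"
      by (intro Lp_sum Lp_abs u)
    moreover have "Lp_norm M p (\<lambda>t. \<Sum>k<m. \<bar>u k t\<bar>) \<le> (\<Sum>k<m. Lp_norm M p (\<lambda>t. \<bar>u k t\<bar>))"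
      by (intro Lp_sum Lp_abs u)
    moreover have "(\<Sum>k<m. Lp_norm M p (\<lambda>t. \<bar>u k t\<bar>)) \<le> S"
      using sum_le_suminf[OF sum, of "{..<m}"] Lp_abs(2)[OF u] by (simp add: S_def Lp_norm_nonneg)
    ultimately have "(\<integral>\<^sup>+t. ennreal (\<bar>\<Sum>k<m. \<bar>u k t\<bar>\<bar> powr p) \<partial>M) \<le> ennreal (S powr p)"
      using Lp_space_norm_le_iff_nn_integral[of "\<lambda>t. \<Sum>k<m. \<bar>u k t\<bar>" S] S0 Lp_space_measurable
      by auto
    then show ?thesis
      by (simp add: G_def abs_of_nonneg sum_nonneg)
  qed
  have "incseq G"
    using p by (auto simp: G_def mono_def le_fun_def intro!: ennreal_leI powr_mono2 sum_mono2 sum_nonneg)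
  then have "(\<integral>\<^sup>+t. (SUP m. G m t) \<partial>M) = (SUP m. \<integral>\<^sup>+t. G m t \<partial>M)"
    using meas by (intro nn_integral_monotone_convergence_SUP) (auto simp: G_def[abs_def])
  also have "\<dots> \<le> ennreal (S powr p)"
    using G_bound by (intro SUP_least)
  finally have "(\<integral>\<^sup>+t. (SUP m. G m t) \<partial>M) \<noteq> \<infinity>"
    by (auto simp: top_unique)
  then have "AE t in M. (SUP m. G m t) \<noteq> \<infinity>"
    using meas by (intro nn_integral_PInf_AE) (auto simp: G_def[abs_def])
  then have ae: "AE t in M. summable (\<lambda>k. u k t)"
  proof eventually_elim
    fix t
    assume "(SUP m. G m t) \<noteq> \<infinity>"
    then obtain B where B: "0 \<le> B" "(SUP m. G m t) = ennreal B"
      by (cases "SUP m. G m t") auto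
    have "(\<Sum>k<m. \<bar>u k t\<bar>) \<le> B powr (1 / p)" for m
    proof -
      have "G m t \<le> ennreal B"
        using SUP_upper[of m UNIV "\<lambda>m. G m t"] B by simp
      then have "(\<Sum>k<m. \<bar>u k t\<bar>) powr p \<le> B"
        using B by (simp add: G_def)
      then have "((\<Sum>k<m. \<bar>u k t\<bar>) powr p) powr (1 / p) \<le> B powr (1 / p)"
        using p by (intro powr_mono2) auto
      then show ?thesis
        using p by (simp add: powr_powr sum_nonneg)
    qed
    then have "summable (\<lambda>k. \<bar>u k t\<bar>)"
      by (intro bounded_imp_summable[where B = "B powr (1 / p)"])
        (auto simp del: sum.lessThan_Suc simp flip: lessThan_Suc_atMost)
    then show "summable (\<lambda>k. u k t)"
      by (rule summable_rabs_cancel)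
  qed
  define f where "f t = (\<Sum>k. u k t)" for t
  have f_meas: "f \<in> borel_measurable M"
    using meas by (auto simp: f_def[abs_def])
  have tail: "(\<lambda>t. f t - (\<Sum>k<m. u k t)) \<in> Lp_space M p \<and>
      Lp_norm M p (\<lambda>t. f t - (\<Sum>k<m. u k t)) \<le> (\<Sum>k. Lp_norm M p (u (k + m)))" for m
  proof (rule Lp_norm_Fatou[where u = "\<lambda>j t. \<Sum>k<j. u (k + m) t"])
    have sm: "summable (\<lambda>k. Lp_norm M p (u (k + m)))"
      using sum by (rule summable_ignore_initial_segment)
    then show "0 \<le> (\<Sum>k. Lp_norm M p (u (k + m)))"
      by (intro suminf_nonneg Lp_norm_nonneg)
    show "(\<lambda>t. \<Sum>k<j. u (k + m) t) \<in> Lp_space M p" for j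
      by (intro Lp_sum u)
    have "Lp_norm M p (\<lambda>t. \<Sum>k<j. u (k + m) t) \<le> (\<Sum>k<j. Lp_norm M p (u (k + m)))" for j
      by (intro Lp_sum u)
    also have "\<And>j. (\<Sum>k<j. Lp_norm M p (u (k + m))) \<le> (\<Sum>k. Lp_norm M p (u (k + m)))"
      by (intro sum_le_suminf sm) (auto simp: Lp_norm_nonneg)
    finally show "Lp_norm M p (\<lambda>t. \<Sum>k<j. u (k + m) t) \<le> (\<Sum>k. Lp_norm M p (u (k + m)))" for j .
    show "AE t in M. (\<lambda>j. \<Sum>k<j. u (k + m) t) \<longlonglongrightarrow> f t - (\<Sum>k<m. u k t)"
      using ae
    proof eventually_elim
      fix t
      assume "summable (\<lambda>k. u k t)"
      then have "(\<lambda>k. u (k + m) t) sums (f t - (\<Sum>k<m. u k t))"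
        unfolding f_def by (intro sums_split_initial_segment summable_sums)
      then show "(\<lambda>j. \<Sum>k<j. u (k + m) t) \<longlonglongrightarrow> f t - (\<Sum>k<m. u k t)"
        by (simp add: sums_def)
    qed
  qed (use f_meas meas in auto)
  show ?thesis
    using that[of f] tail tail[of 0] by auto
qed

end

section \<open>Zabreiko's lemma\<close>

text \<open>
  A countably subadditive seminorm \<open>q\<close> on a space that is complete for a seminorm \<open>n\<close> is bounded by a
  multiple of \<open>n\<close>. By completeness one of the sets \<open>{q \<le> k}\<close> is dense in some ball, and by
  subadditivity and homogeneity this density moves to balls around \<open>0\<close> of every radius. A vector is
  then a sum of successive approximation errors with geometrically decreasing \<open>q\<close>, and countable
  subadditivity bounds its own \<open>q\<close>. Applied to the norm of the coefficients with respect to a basis,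
  this replaces the open mapping theorem.
\<close>

lemma complete_norm_dominates_countably_subadditive:
  fixes E :: "('a \<Rightarrow> real) set" and n q :: "('a \<Rightarrow> real) \<Rightarrow> real"
  assumes zero: "(\<lambda>t. 0) \<in> E"
    and lin: "\<And>f g c. f \<in> E \<Longrightarrow> g \<in> E \<Longrightarrow> (\<lambda>t. f t + c * g t) \<in> E"
    and n_nonneg: "\<And>f. 0 \<le> n f"
    and n_zero: "n (\<lambda>t. 0) = 0"
    and n_add: "\<And>f g c. f \<in> E \<Longrightarrow> g \<in> E \<Longrightarrow> n (\<lambda>t. f t + c * g t) \<le> n f + \<bar>c\<bar> * n g"
    and q_nonneg: "\<And>f. f \<in> E \<Longrightarrow> 0 \<le> q f"
    and q_zero: "q (\<lambda>t. 0) = 0"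
    and q_add: "\<And>f g c. f \<in> E \<Longrightarrow> g \<in> E \<Longrightarrow> q (\<lambda>t. f t + c * g t) \<le> q f + \<bar>c\<bar> * q g"
    and complete: "\<And>u. (\<And>k. u k \<in> E) \<Longrightarrow> summable (\<lambda>k. n (u k)) \<Longrightarrow>
      \<exists>f\<in>E. (\<lambda>m. n (\<lambda>t. f t - (\<Sum>k<m. u k t))) \<longlonglongrightarrow> 0"
    and q_series: "\<And>u f. (\<And>k. u k \<in> E) \<Longrightarrow> f \<in> E \<Longrightarrow> summable (\<lambda>k. q (u k)) \<Longrightarrow>
      (\<lambda>m. n (\<lambda>t. f t - (\<Sum>k<m. u k t))) \<longlonglongrightarrow> 0 \<Longrightarrow> q f \<le> (\<Sum>k. q (u k))"
  shows "\<exists>K. \<forall>f\<in>E. q f \<le> K * n f"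
proof -
  have diff: "(\<lambda>t. f t - g t) \<in> E" "n (\<lambda>t. f t - g t) \<le> n f + n g" "q (\<lambda>t. f t - g t) \<le> q f + q g"
    if "f \<in> E" "g \<in> E" for f g
    using lin[OF that, of "- 1"] n_add[OF that, of "- 1"] q_add[OF that, of "- 1"] by auto
  have scale: "(\<lambda>t. c * f t) \<in> E" "n (\<lambda>t. c * f t) \<le> \<bar>c\<bar> * n f" "q (\<lambda>t. c * f t) \<le> \<bar>c\<bar> * q f"
    if "f \<in> E" for f c
    using lin[OF zero that, of c] n_add[OF zero that, of c] q_add[OF zero that, of c]
    by (auto simp: n_zero q_zero)

  \<comment> \<open>Baire category: some set \<open>{q \<le> k}\<close> is \<open>n\<close>-dense in a ball, since otherwise nested balls escaping
    \<open>{q \<le> k}\<close> for each \<open>k\<close> would shrink to a point where \<open>q\<close> exceeds every integer.\<close>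
  have "\<exists>(k::nat) f0 r. f0 \<in> E \<and> 0 < r \<and>
      (\<forall>g\<in>E. n g < r \<longrightarrow> (\<forall>e>0. \<exists>h\<in>E. q h \<le> k \<and> n (\<lambda>t. f0 t + g t - h t) < e))"
  proof (rule ccontr)
    assume no_ball: "\<not> ?thesis"
    have escape: "\<exists>g\<in>E. n g < r \<and> (\<exists>e>0. \<forall>h\<in>E. q h \<le> real k \<longrightarrow> e \<le> n (\<lambda>t. f0 t + g t - h t))"
      if "f0 \<in> E" "0 < r" for k f0 r
    proof -
      have "\<not> (f0 \<in> E \<and> 0 < r \<and>
          (\<forall>g\<in>E. n g < r \<longrightarrow> (\<forall>e>0. \<exists>h\<in>E. q h \<le> real k \<and> n (\<lambda>t. f0 t + g t - h t) < e)))"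
        using no_ball by blast
      with that show ?thesis
        unfolding not_less[symmetric] by blast
    qed
    \<comment> \<open>A state consists of the centre and the radius of a ball. The factor \<open>4\<close> leaves room for the limit,
      which can drift from a centre by up to twice the radius.\<close>
    define P where "P k c \<longleftrightarrow> fst c \<in> E \<and> 0 < snd c" for k :: nat and c :: "('a \<Rightarrow> real) \<times> real"
    define Q where "Q k c d \<longleftrightarrow> n (\<lambda>t. fst d t - fst c t) < snd c \<and> snd d \<le> snd c / 2 \<and>
      (\<forall>h\<in>E. q h \<le> real k \<longrightarrow> 4 * snd d \<le> n (\<lambda>t. fst d t - h t))"
      for k and c d :: "('a \<Rightarrow> real) \<times> real"
    have "\<exists>c. \<forall>k. P k (c k) \<and> Q k (c k) (c (Suc k))"
    proof (rule dependent_nat_choice)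
      show "\<exists>c. P 0 c"
        using zero by (intro exI[of _ "(\<lambda>t. 0, 1)"]) (auto simp: P_def)
      show "\<exists>d. P (Suc k) d \<and> Q k c d" if c: "P k c" for c k
      proof -
        have cE: "fst c \<in> E" "0 < snd c"
          using c by (auto simp: P_def)
        obtain g e where g: "g \<in> E" "n g < snd c" "0 < e"
            "\<And>h. h \<in> E \<Longrightarrow> q h \<le> real k \<Longrightarrow> e \<le> n (\<lambda>t. fst c t + g t - h t)"
          using escape[OF cE, of k] by blast
        have "(\<lambda>t. fst c t + g t) \<in> E"
          using lin[OF cE(1) g(1), of 1] by simp
        moreover have "\<exists>d>0. d \<le> snd c / 2 \<and> 4 * d \<le> e"
          using g(3) cE(2) by (intro exI[of _ "min (e / 4) (snd c / 2)"]) auto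
        then obtain d where "0 < d" "d \<le> snd c / 2" "4 * d \<le> e"
          by blast
        ultimately show ?thesis
          using g cE
          by (intro exI[of _ "(\<lambda>t. fst c t + g t, d)"]) (auto simp: P_def Q_def intro: order_trans)
      qed
    qed
    then obtain c where c: "\<And>k. P k (c k)" "\<And>k. Q k (c k) (c (Suc k))"
      by blast
    define F where "F k = fst (c k)" for k
    define R where "R k = snd (c k)" for k
    \<comment> \<open>Completeness is stated for series, so the centres become partial sums.\<close>
    define u where "u k = (case k of 0 \<Rightarrow> F 0 | Suc j \<Rightarrow> (\<lambda>t. F (Suc j) t - F j t))" for k
    have F: "F k \<in> E" and R: "0 < R k" "R (Suc k) \<le> R k / 2"
      and step: "n (\<lambda>t. F (Suc k) t - F k t) < R k"
      and avoid: "h \<in> E \<Longrightarrow> q h \<le> real k \<Longrightarrow> 4 * R (Suc k) \<le> n (\<lambda>t. F (Suc k) t - h t)" for k h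
      using c[of k] by (auto simp: P_def Q_def F_def R_def)
    have uE: "u k \<in> E" for k
      using F diff(1) by (auto simp: u_def split: nat.split)
    have u_sum: "(\<Sum>k<Suc m. u k t) = F m t" for m t
      by (induction m) (auto simp: u_def)
    have R_geom: "R k \<le> R 0 * (1 / 2) ^ k" for k
    proof (induction k)
      case (Suc k)
      then show ?case
        using R(2)[of k] by simp
    qed simp
    have "summable (\<lambda>k. n (u k))"
    proof -
      have "summable (\<lambda>k. n (u (Suc k)))"
      proof (rule summable_comparison_test'[where N = 0])
        show "summable (\<lambda>k. R 0 * (1 / 2) ^ k)"
          by (intro summable_mult summable_geometric) simp
        show "norm (n (u (Suc k))) \<le> R 0 * (1 / 2) ^ k" for k
          using step[of k] R_geom[of k] n_nonneg by (simp add: u_def)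
      qed
      then show ?thesis
        using summable_Suc_iff[of "\<lambda>k. n (u k)"] by simp
    qed
    then obtain f where f: "f \<in> E" and "(\<lambda>m. n (\<lambda>t. f t - (\<Sum>k<m. u k t))) \<longlonglongrightarrow> 0"
      using complete[of u] uE by blast
    then have lim: "(\<lambda>m. n (\<lambda>t. f t - F m t)) \<longlonglongrightarrow> 0"
      by (subst (asm) filterlim_sequentially_Suc[symmetric]) (simp only: u_sum)
    have near: "n (\<lambda>t. F m t - F j t) \<le> 2 * R j - 2 * R m" if "j \<le> m" for j m
      using that
    proof (induction m rule: dec_induct)
      case base
      then show ?case by (simp add: n_zero)
    next
      case (step m)
      have "n (\<lambda>t. (F m t - F j t) + 1 * (F (Suc m) t - F m t))
          \<le> n (\<lambda>t. F m t - F j t) + \<bar>1\<bar> * n (\<lambda>t. F (Suc m) t - F m t)"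
        by (intro n_add diff F)
      then show ?case
        using step \<open>n (\<lambda>t. F (Suc m) t - F m t) < R m\<close> R(2)[of m] by simp
    qed
    obtain k :: nat where k: "q f \<le> real k"
      using real_arch_simple by blast
    obtain m0 where "\<And>m. m0 \<le> m \<Longrightarrow> n (\<lambda>t. f t - F m t) < R (Suc k)"
      using order_tendstoD(2)[OF lim R(1)[of "Suc k"]] by (auto simp: eventually_sequentially)
    then obtain m where m: "Suc k \<le> m" "n (\<lambda>t. f t - F m t) < R (Suc k)"
      by (meson max.cobounded1 max.cobounded2)
    have "n (\<lambda>t. F (Suc k) t - f t) \<le> n (\<lambda>t. F m t - F (Suc k) t) + n (\<lambda>t. f t - F m t)"
    proof -
      have "n (\<lambda>t. -1 * ((F m t - F (Suc k) t) + 1 * (f t - F m t))) \<le>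
          \<bar>-1\<bar> * n (\<lambda>t. (F m t - F (Suc k) t) + 1 * (f t - F m t))"
        by (intro scale lin diff F f)
      also have "\<dots> \<le> n (\<lambda>t. F m t - F (Suc k) t) + n (\<lambda>t. f t - F m t)"
        using n_add[OF diff(1)[OF F[of m] F[of "Suc k"]] diff(1)[OF f F[of m]], of 1] by simp
      finally show ?thesis
        by simp
    qed
    also have "\<dots> < 4 * R (Suc k)"
      using near[OF m(1)] m(2) R(1)[of m] R(1)[of "Suc k"] by simp
    finally show False
      using avoid[OF f k] by simp
  qed
  then obtain k :: nat and f0 r where f0: "f0 \<in> E" "0 < r"
      and dense: "\<And>g e. g \<in> E \<Longrightarrow> n g < r \<Longrightarrow> 0 < e \<Longrightarrow>
        \<exists>h\<in>E. q h \<le> k \<and> n (\<lambda>t. f0 t + g t - h t) < e"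
    by blast
  define L where "L = 2 * real k / r"
  have L0: "0 \<le> L"
    using f0 by (simp add: L_def)
  \<comment> \<open>Subtracting the approximations of \<open>f0 + g\<close> and of \<open>f0\<close> moves the ball to the origin.\<close>
  have dense0: "\<exists>h\<in>E. q h \<le> 2 * k \<and> n (\<lambda>t. g t - h t) < e" if g: "g \<in> E" "n g < r" "0 < e" for g e
  proof -
    obtain h1 where h1: "h1 \<in> E" "q h1 \<le> k" "n (\<lambda>t. f0 t + g t - h1 t) < e / 2"
      using dense[OF g(1,2), of "e / 2"] g(3) by auto
    obtain h2 where h2: "h2 \<in> E" "q h2 \<le> k" "n (\<lambda>t. f0 t - h2 t) < e / 2"
      using dense[OF zero, of "e / 2"] g(3) f0(2) n_zero by auto
    have "(\<lambda>t. f0 t + g t) \<in> E"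
      using lin[OF f0(1) g(1), of 1] by simp
    from diff(2)[OF diff(1)[OF this h1(1)] diff(1)[OF f0(1) h2(1)]] h1(3) h2(3)
    have "n (\<lambda>t. g t - (h1 t - h2 t)) < e"
      by (simp add: algebra_simps)
    moreover have "q (\<lambda>t. h1 t - h2 t) \<le> 2 * k"
      using diff(3)[OF h1(1) h2(1)] h1(2) h2(2) by simp
    ultimately show ?thesis
      using diff(1)[OF h1(1) h2(1)] by auto
  qed
  have approx: "\<exists>h\<in>E. q h \<le> L * s \<and> n (\<lambda>t. g t - h t) < e" if g: "g \<in> E" "n g < s" and e: "0 < e" for g s e
  proof -
    have s: "0 < s"
      using g n_nonneg[of g] by simp
    have "n (\<lambda>t. r / s * g t) < r"
      using g(2) s f0(2)
      by (intro le_less_trans[OF scale(2)[OF g(1), of "r / s"]]) (auto simp: field_simps)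
    from dense0[OF scale(1)[OF g(1)] this, of "r / s * e"]
    obtain h where h: "h \<in> E" "q h \<le> 2 * k" "n (\<lambda>t. r / s * g t - h t) < r / s * e"
      using s e f0(2) by auto
    have "n (\<lambda>t. s / r * (r / s * g t - h t)) \<le> \<bar>s / r\<bar> * n (\<lambda>t. r / s * g t - h t)"
      by (intro scale diff g h)
    also have "\<dots> < \<bar>s / r\<bar> * (r / s * e)"
      using h(3) s f0(2) by (intro mult_strict_left_mono) auto
    also have "\<dots> = e"
      using s f0(2) by simp
    also have "(\<lambda>t. s / r * (r / s * g t - h t)) = (\<lambda>t. g t - s / r * h t)"
      using s f0(2) by (simp add: right_diff_distrib)
    finally have "n (\<lambda>t. g t - s / r * h t) < e" .
    moreover have "q (\<lambda>t. s / r * h t) \<le> L * s"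
    proof -
      have "q (\<lambda>t. s / r * h t) \<le> \<bar>s / r\<bar> * q h"
        by (intro scale h)
      also have "\<dots> \<le> \<bar>s / r\<bar> * (2 * k)"
        using h(2) by (intro mult_left_mono) auto
      finally show ?thesis
        using s f0(2) by (simp add: L_def field_simps)
    qed
    ultimately show ?thesis
      using scale(1)[OF h(1)] by blast
  qed
  \<comment> \<open>\<open>v j\<close> is the error left after \<open>j\<close> approximations; each step halves the bound on it.\<close>
  have bound: "q g \<le> 2 * L * s" if g: "g \<in> E" "n g < s" for g s
  proof -
    have s: "0 < s"
      using g n_nonneg[of g] by simp
    have "\<exists>v. \<forall>j. (v j \<in> E \<and> n (v j) < s / 2 ^ j \<and> (j = 0 \<longrightarrow> v j = g)) \<and>
        q (\<lambda>t. v j t - v (Suc j) t) \<le> L * s / 2 ^ j"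
    proof (rule dependent_nat_choice)
      show "\<exists>w. w \<in> E \<and> n w < s / 2 ^ 0 \<and> ((0::nat) = 0 \<longrightarrow> w = g)"
        using g by auto
    next
      fix w and j :: nat
      assume w: "w \<in> E \<and> n w < s / 2 ^ j \<and> (j = 0 \<longrightarrow> w = g)"
      obtain h where h: "h \<in> E" "q h \<le> L * (s / 2 ^ j)" "n (\<lambda>t. w t - h t) < s / 2 ^ Suc j"
        using approx[of w "s / 2 ^ j" "s / 2 ^ Suc j"] w s by auto
      then show "\<exists>w'. (w' \<in> E \<and> n w' < s / 2 ^ Suc j \<and> (Suc j = 0 \<longrightarrow> w' = g)) \<and>
          q (\<lambda>t. w t - w' t) \<le> L * s / 2 ^ j"
        using diff(1)[of w h] w by (intro exI[of _ "\<lambda>t. w t - h t"]) simp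
    qed
    then obtain v where v: "\<And>j. v j \<in> E" "\<And>j. n (v j) < s / 2 ^ j" "v 0 = g"
        and qv: "\<And>j. q (\<lambda>t. v j t - v (Suc j) t) \<le> L * s / 2 ^ j"
      by metis
    define u where "u j t = v j t - v (Suc j) t" for j t
    have uE: "u j \<in> E" for j
      unfolding u_def[abs_def] by (intro diff v)
    have tel: "g t - (\<Sum>j<m. u j t) = v m t" for m t
      by (induction m) (auto simp: u_def v(3))
    have geo: "(\<lambda>j. L * s / 2 ^ j) sums (L * s * 2)"
      using sums_mult[OF geometric_sums[of "1 / 2 :: real"], of "L * s"]
      by (simp add: power_one_over divide_simps)
    have qu: "0 \<le> q (u j)" "q (u j) \<le> L * s / 2 ^ j" for j
      using q_nonneg[OF uE] qv by (auto simp: u_def[abs_def])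
    have sq: "summable (\<lambda>j. q (u j))"
      using qu by (intro summable_comparison_test'[OF sums_summable[OF geo], of 0]) auto
    have "(\<lambda>m. s / 2 ^ m) \<longlonglongrightarrow> 0"
      using tendsto_mult[OF tendsto_const LIMSEQ_power_zero[of "1 / 2 :: real"], of s]
      by (simp add: power_one_over)
    then have "(\<lambda>m. n (v m)) \<longlonglongrightarrow> 0"
      by (rule tendsto_sandwich[rotated 3, OF _ ])
        (auto intro!: always_eventually n_nonneg less_imp_le[OF v(2)])
    then have "q g \<le> (\<Sum>j. q (u j))"
      using g(1) uE sq by (intro q_series) (auto simp: tel)
    also have "\<dots> \<le> (\<Sum>j. L * s / 2 ^ j)"
      using qu sq geo by (intro suminf_le sums_summable[OF geo]) auto
    also have "\<dots> = 2 * L * s"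
      using sums_unique[OF geo] by simp
    finally show ?thesis .
  qed
  show ?thesis
  proof (intro exI ballI)
    fix f
    assume f: "f \<in> E"
    show "q f \<le> 2 * L * n f"
    proof (rule field_le_epsilon)
      fix e :: real
      assume e: "0 < e"
      have "q f \<le> 2 * L * (n f + e / (2 * L + 1))"
        using e L0 by (intro bound f) auto
      also have "\<dots> \<le> 2 * L * n f + e"
        using e L0 by (simp add: algebra_simps divide_simps)
      finally show "q f \<le> 2 * L * n f + e" .
    qed
  qed
qed

section \<open>Unconditional summability\<close>

lemma ex_permutation_listing_subset_first:
  fixes a b :: nat
  assumes "a \<le> b"
  shows "\<exists>\<sigma>. bij_betw \<sigma> {a..<b} {a..<b} \<and>
    \<sigma> ` {a..<a + card (P \<inter> {a..<b})} = P \<inter> {a..<b}"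
proof -
  define c where "c = card (P \<inter> {a..<b})"
  have c: "a + c \<le> b"
    using card_mono[of "{a..<b}" "P \<inter> {a..<b}"] assms by (simp add: c_def)
  obtain f1 where f1: "bij_betw f1 {a..<a + c} (P \<inter> {a..<b})"
    using finite_same_card_bij[of "{a..<a + c}" "P \<inter> {a..<b}"] by (auto simp: c_def)
  have "card ({a..<b} - P) = b - a - c"
    using card_Diff_subset_Int[of "{a..<b}" P] by (simp add: c_def Int_commute)
  then obtain f2 where f2: "bij_betw f2 {a + c..<b} ({a..<b} - P)"
    using finite_same_card_bij[of "{a + c..<b}" "{a..<b} - P"] by auto
  define \<sigma> where "\<sigma> i = (if i \<in> {a..<a + c} then f1 i else f2 i)" for i
  have "bij_betw \<sigma> ({a..<a + c} \<union> {a + c..<b}) (P \<inter> {a..<b} \<union> ({a..<b} - P))"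
    unfolding \<sigma>_def[abs_def] using f1 f2 by (intro bij_betw_disjoint_Un) auto
  moreover have "{a..<a + c} \<union> {a + c..<b} = {a..<b}" "P \<inter> {a..<b} \<union> ({a..<b} - P) = {a..<b}"
    using c by auto
  moreover have "\<sigma> ` {a..<a + c} = P \<inter> {a..<b}"
    using f1 by (auto simp: \<sigma>_def bij_betw_def)
  ultimately show ?thesis
    unfolding c_def by (intro exI[of _ \<sigma>]) simp
qed

text \<open>
  Cutting \<open>\<nat>\<close> into consecutive blocks and listing the elements of \<open>P\<close> first inside each block exhibits
  the sums over \<open>P\<close> in each block as differences of partial sums of one rearranged series.
\<close>

lemma ex_block_rearrangement:
  fixes m :: "nat \<Rightarrow> nat" and P :: "nat set"
  assumes m: "strict_mono m" "m 0 = 0"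
  obtains \<pi> where "bij \<pi>"
    "\<And>k. \<pi> ` {m k..<m k + card (P \<inter> {m k..<m (Suc k)})} = P \<inter> {m k..<m (Suc k)}"
proof -
  define I where "I k = {m k..<m (Suc k)}" for k
  have m_le: "m k \<le> m l" if "k \<le> l" for k l
    using m(1) that by (simp add: strict_mono_less_eq)
  have "\<exists>k. n \<in> I k" for n
  proof (induction n)
    case 0
    show ?case
      using m strict_monoD[OF m(1), of 0 1] by (intro exI[of _ 0]) (simp add: I_def)
  next
    case (Suc n)
    then obtain k where "n \<in> I k"
      by blast
    then show ?case
      using strict_monoD[OF m(1), of "Suc k" "Suc (Suc k)"]
      by (cases "Suc n < m (Suc k)") (auto simp: I_def intro: exI[of _ k] exI[of _ "Suc k"])
  qed
  then obtain j where j: "\<And>n. n \<in> I (j n)"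
    by metis
  have j_eq: "j n = k" if "n \<in> I k" for n k
    using j[of n] that m_le[of "Suc (j n)" k] m_le[of "Suc k" "j n"]
    by (cases "j n" k rule: linorder_cases) (auto simp: I_def)
  have "\<exists>\<sigma>. bij_betw \<sigma> (I k) (I k) \<and> \<sigma> ` {m k..<m k + card (P \<inter> I k)} = P \<inter> I k" for k
    unfolding I_def by (intro ex_permutation_listing_subset_first m_le) simp
  then obtain \<sigma> where \<sigma>: "\<And>k. bij_betw (\<sigma> k) (I k) (I k)"
      "\<And>k. \<sigma> k ` {m k..<m k + card (P \<inter> I k)} = P \<inter> I k"
    by metis
  define \<pi> where "\<pi> n = \<sigma> (j n) n" for n
  have \<pi>_eq: "\<pi> n = \<sigma> k n" if "n \<in> I k" for n k
    using j_eq[OF that] by (simp add: \<pi>_def)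
  have "bij_betw \<pi> (\<Union>k. I k) (\<Union>k. I k)"
  proof (rule bij_betw_UNION_disjoint)
    show "disjoint_family_on I UNIV"
      using j_eq by (auto simp: disjoint_family_on_def)
    show "bij_betw \<pi> (I k) (I k)" for k
      using \<sigma>(1)[of k] bij_betw_cong[of "I k" \<pi> "\<sigma> k"] \<pi>_eq by auto
  qed
  moreover have "(\<Union>k. I k) = UNIV"
    using j by auto
  moreover have "\<pi> ` {m k..<m k + card (P \<inter> I k)} = P \<inter> I k" for k
  proof -
    have "card (P \<inter> I k) \<le> card (I k)"
      by (intro card_mono) (auto simp: I_def)
    then have "{m k..<m k + card (P \<inter> I k)} \<subseteq> I k"
      by (auto simp: I_def)
    then show ?thesis
      using \<pi>_eq \<sigma>(2)[of k] by (metis (no_types, lifting) image_cong subsetD)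
  qed
  ultimately show ?thesis
    using that[of \<pi>] by (simp add: I_def)
qed

context Lp_exponent
begin

text \<open>
  If the partial sums over \<open>P\<close> were unbounded, then from every index on some further block would
  contribute norm at least \<open>1\<close> to them; a rearrangement that lists \<open>P\<close> first in each of these blocks
  would not have Cauchy partial sums.
\<close>

lemma unconditionally_summable_subseries_bounded:
  assumes y: "Lp_unconditionally_summable M p y"
  shows "\<exists>B. \<forall>N. Lp_norm M p (\<lambda>t. \<Sum>n\<in>P \<inter> {..<N}. y n t) \<le> B"
proof -
  have yL: "y n \<in> Lp_space M p" for n
    using y[unfolded Lp_unconditionally_summable_def, rule_format, of id] by (auto simp: Lp_sums_def)
  define s where "s A = Lp_norm M p (\<lambda>t. \<Sum>n\<in>A. y n t)" for A :: "nat set"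
  have "\<exists>m. \<forall>N>m. s (P \<inter> {m..<N}) < 1"
  proof (rule ccontr)
    assume "\<not> ?thesis"
    then have later: "\<exists>N>m. 1 \<le> s (P \<inter> {m..<N})" for m
      by (meson not_less)
    have "\<exists>m. \<forall>k. (k = 0 \<longrightarrow> m k = 0) \<and> (m k < m (Suc k) \<and> 1 \<le> s (P \<inter> {m k..<m (Suc k)}))"
      by (rule dependent_nat_choice) (use later in auto)
    then obtain m where m: "m 0 = 0" "strict_mono m" "\<And>k. 1 \<le> s (P \<inter> {m k..<m (Suc k)})"
      by (metis strict_mono_Suc_iff)
    obtain \<pi> where \<pi>: "bij \<pi>"
        "\<And>k. \<pi> ` {m k..<m k + card (P \<inter> {m k..<m (Suc k)})} = P \<inter> {m k..<m (Suc k)}"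
      using ex_block_rearrangement[OF m(2,1)] by metis
    obtain g where g: "g \<in> Lp_space M p"
        "(\<lambda>N. Lp_norm M p (\<lambda>t. g t - (\<Sum>n<N. y (\<pi> n) t))) \<longlonglongrightarrow> 0"
      using y \<pi>(1) by (auto simp: Lp_unconditionally_summable_def Lp_sums_def)
    define G where "G N t = g t - (\<Sum>n<N. y (\<pi> n) t)" for N t
    have G: "G N \<in> Lp_space M p" for N
      unfolding G_def[abs_def] by (intro Lp_diff g Lp_sum yL)
    have "\<forall>\<^sub>F N in sequentially. Lp_norm M p (G N) < 1 / 2"
      using order_tendstoD(2)[OF g(2), of "1 / 2"] by (simp add: G_def[abs_def])
    then obtain N0 where N0: "\<And>N. N \<ge> N0 \<Longrightarrow> Lp_norm M p (G N) < 1 / 2"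
      by (auto simp: eventually_sequentially)
    define a where "a = m N0"
    define b where "b = a + card (P \<inter> {a..<m (Suc N0)})"
    have a: "N0 \<le> a" "a \<le> b"
      using m(2) by (auto simp: a_def b_def strict_mono_imp_increasing)
    have "(\<Sum>n\<in>P \<inter> {a..<m (Suc N0)}. y n t) = G a t - G b t" for t
    proof -
      have img: "P \<inter> {a..<m (Suc N0)} = \<pi> ` {a..<b}"
        using \<pi>(2)[of N0] by (simp add: a_def b_def)
      have "(\<Sum>n\<in>P \<inter> {a..<m (Suc N0)}. y n t) = (\<Sum>n\<in>{a..<b}. y (\<pi> n) t)"
        unfolding img using inj_on_subset[OF bij_is_inj[OF \<pi>(1)]] by (subst sum.reindex) auto
      also have "\<dots> = G a t - G b t"
        using a(2) by (simp add: G_def sum_diff_nat_ivl flip: atLeast0LessThan)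
      finally show ?thesis .
    qed
    then have "s (P \<inter> {a..<m (Suc N0)}) = Lp_norm M p (\<lambda>t. G a t - G b t)"
      by (simp add: s_def)
    also have "\<dots> \<le> Lp_norm M p (G a) + Lp_norm M p (G b)"
      by (intro Lp_diff G)
    also have "\<dots> < 1"
      using N0[OF a(1)] N0[of b] a by simp
    finally show False
      using m(3)[of N0] by (simp add: a_def)
  qed
  then obtain m where m: "\<And>N. m < N \<Longrightarrow> s (P \<inter> {m..<N}) < 1"
    by blast
  have "s (P \<inter> {..<N}) \<le> (\<Sum>n<m. Lp_norm M p (y n)) + 1" for N
  proof (cases "N \<le> m")
    case True
    have "s (P \<inter> {..<N}) \<le> (\<Sum>n\<in>P \<inter> {..<N}. Lp_norm M p (y n))"
      unfolding s_def by (intro Lp_sum yL)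
    also have "\<dots> \<le> (\<Sum>n<m. Lp_norm M p (y n))"
      using True by (intro sum_mono2) (auto simp: Lp_norm_nonneg)
    finally show ?thesis
      by simp
  next
    case False
    have "(\<Sum>n\<in>P \<inter> {..<N}. y n t) = (\<Sum>n\<in>P \<inter> {..<m}. y n t) + (\<Sum>n\<in>P \<inter> {m..<N}. y n t)" for t
      using False by (subst sum.union_disjoint[symmetric]) (auto intro!: sum.cong)
    then have "s (P \<inter> {..<N}) \<le> s (P \<inter> {..<m}) + s (P \<inter> {m..<N})"
      using Lp_add(2)[OF Lp_sum(1)[of "P \<inter> {..<m}" y] Lp_sum(1)[of "P \<inter> {m..<N}" y]] yL
      by (simp add: s_def)
    also have "s (P \<inter> {..<m}) \<le> (\<Sum>n\<in>P \<inter> {..<m}. Lp_norm M p (y n))"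
      unfolding s_def by (intro Lp_sum yL)
    also have "\<dots> \<le> (\<Sum>n<m. Lp_norm M p (y n))"
      by (intro sum_mono2) (auto simp: Lp_norm_nonneg)
    finally show ?thesis
      using m[of N] False by simp
  qed
  then show ?thesis
    unfolding s_def by blast
qed

text \<open>
  For terms of constant sign the absolute values are a difference of two subseries.
\<close>

lemma unconditionally_summable_abs_bounded:
  assumes y: "Lp_unconditionally_summable M p y"
    and sign: "\<And>n. (AE t in M. 0 \<le> y n t) \<or> (AE t in M. y n t \<le> 0)"
  shows "\<exists>B. \<forall>N. Lp_norm M p (\<lambda>t. \<Sum>n<N. \<bar>y n t\<bar>) \<le> B"
proof -
  have yL: "y n \<in> Lp_space M p" for n
    using y[unfolded Lp_unconditionally_summable_def, rule_format, of id] by (auto simp: Lp_sums_def)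
  define P where "P = {n. AE t in M. 0 \<le> y n t}"
  obtain B C where B: "\<And>N. Lp_norm M p (\<lambda>t. \<Sum>n\<in>P \<inter> {..<N}. y n t) \<le> B"
      and C: "\<And>N. Lp_norm M p (\<lambda>t. \<Sum>n\<in>- P \<inter> {..<N}. y n t) \<le> C"
    using unconditionally_summable_subseries_bounded[OF y] by metis
  have "Lp_norm M p (\<lambda>t. \<Sum>n<N. \<bar>y n t\<bar>) \<le> B + C" for N
  proof -
    have "AE t in M. \<forall>n. \<bar>y n t\<bar> = (if n \<in> P then y n t else - y n t)"
      unfolding AE_all_countable
    proof
      fix n
      show "AE t in M. \<bar>y n t\<bar> = (if n \<in> P then y n t else - y n t)"
      proof (cases "n \<in> P")
        case True
        then have "AE t in M. 0 \<le> y n t"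
          by (simp add: P_def)
        then show ?thesis
          by eventually_elim (use True in simp)
      next
        case False
        then have "AE t in M. y n t \<le> 0"
          using sign[of n] by (simp add: P_def)
        then show ?thesis
          by eventually_elim (use False in simp)
      qed
    qed
    then have "AE t in M. \<bar>\<Sum>n<N. \<bar>y n t\<bar>\<bar> =
        \<bar>(\<Sum>n\<in>P \<inter> {..<N}. y n t) - (\<Sum>n\<in>- P \<inter> {..<N}. y n t)\<bar>"
    proof eventually_elim
      fix t
      assume *: "\<forall>n. \<bar>y n t\<bar> = (if n \<in> P then y n t else - y n t)"
      have "(\<Sum>n<N. \<bar>y n t\<bar>) = (\<Sum>n\<in>P \<inter> {..<N}. \<bar>y n t\<bar>) + (\<Sum>n\<in>- P \<inter> {..<N}. \<bar>y n t\<bar>)"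
        by (subst sum.union_disjoint[symmetric]) (auto intro!: sum.cong)
      also have "(\<Sum>n\<in>P \<inter> {..<N}. \<bar>y n t\<bar>) = (\<Sum>n\<in>P \<inter> {..<N}. y n t)"
        using * by (intro sum.cong) auto
      also have "(\<Sum>n\<in>- P \<inter> {..<N}. \<bar>y n t\<bar>) = - (\<Sum>n\<in>- P \<inter> {..<N}. y n t)"
        using * by (subst sum_negf[symmetric], intro sum.cong) auto
      finally show "\<bar>\<Sum>n<N. \<bar>y n t\<bar>\<bar> =
          \<bar>(\<Sum>n\<in>P \<inter> {..<N}. y n t) - (\<Sum>n\<in>- P \<inter> {..<N}. y n t)\<bar>"
        by simp
    qed
    then have "Lp_norm M p (\<lambda>t. \<Sum>n<N. \<bar>y n t\<bar>) =
        Lp_norm M p (\<lambda>t. (\<Sum>n\<in>P \<inter> {..<N}. y n t) - (\<Sum>n\<in>- P \<inter> {..<N}. y n t))"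
      using yL[THEN Lp_space_measurable] by (intro Lp_norm_cong_AE) auto
    also have "\<dots> \<le> Lp_norm M p (\<lambda>t. \<Sum>n\<in>P \<inter> {..<N}. y n t) +
        Lp_norm M p (\<lambda>t. \<Sum>n\<in>- P \<inter> {..<N}. y n t)"
      by (intro Lp_diff Lp_sum yL)
    also have "\<dots> \<le> B + C"
      using B C by (intro add_mono)
    finally show ?thesis .
  qed
  then show ?thesis
    by blast
qed

end

section \<open>Averages over signs\<close>

lemma exp_plus_exp_minus_le:
  fixes z :: real
  assumes "\<bar>z\<bar> \<le> 1"
  shows "exp z + exp (- z) \<le> 2 * exp (z\<^sup>2)"
proof -
  have pos: "exp w + exp (- w) \<le> 2 * exp (w\<^sup>2)" if w: "0 \<le> w" "w \<le> 1" for w :: real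
  proof -
    have "exp (- w) \<le> 1 - w + w\<^sup>2"
    proof -
      have "1 \<le> (1 - w + w\<^sup>2) * (1 + w + w\<^sup>2 / 2)"
      proof -
        have "(1 - w + w\<^sup>2) * (1 + w + w\<^sup>2 / 2) = 1 + w\<^sup>2 / 2 + w ^ 3 / 2 + w ^ 4 / 2"
          by (simp add: field_simps power2_eq_square power3_eq_cube power4_eq_xxxx)
        then show ?thesis
          using w by simp
      qed
      also have "\<dots> \<le> (1 - w + w\<^sup>2) * exp w"
        using w by (intro mult_left_mono exp_lower_Taylor_quadratic) auto
      finally show ?thesis
        by (simp add: exp_minus divide_simps mult.commute)
    qed
    moreover have "exp w \<le> 1 + w + w\<^sup>2"
      using w by (intro exp_bound)
    moreover have "1 + w\<^sup>2 \<le> exp (w\<^sup>2)"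
      by (rule exp_ge_add_one_self)
    ultimately show ?thesis
      by linarith
  qed
  show ?thesis
    using pos[of "\<bar>z\<bar>"] assms by (cases "0 \<le> z") (auto simp: add.commute)
qed

lemma powr_le_exp:
  fixes p s :: real
  assumes "0 < p" "0 \<le> s"
  shows "s powr p \<le> p powr p * exp s"
proof -
  have "s / p \<le> exp (s / p)"
    using exp_ge_add_one_self[of "s / p"] by linarith
  then have "s \<le> p * exp (s / p)"
    using assms by (simp add: field_simps)
  then have "s powr p \<le> (p * exp (s / p)) powr p"
    using assms by (intro powr_mono2) auto
  also have "\<dots> = p powr p * exp s"
    using assms by (simp add: powr_mult exp_powr_real)
  finally show ?thesis .
qed

text \<open>
  For \<open>X \<subseteq> I\<close> the difference \<open>\<Sum>\<^sub>X y - \<Sum>\<^sub>I\<^sub>-\<^sub>X y\<close> is the sum of \<open>y\<close> with sign \<open>+\<close> on \<open>X\<close> and \<open>-\<close> off \<open>X\<close>, so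
  that a sum over \<open>Pow I\<close> is \<open>2\<^sup>\<bar>\<^sup>I\<^sup>\<bar>\<close> times an average over independent random signs.
\<close>

lemma sum_exp_signed_sums:
  fixes y :: "'i \<Rightarrow> real"
  assumes I: "finite I"
  shows "(\<Sum>X\<in>Pow I. exp ((\<Sum>i\<in>X. y i) - (\<Sum>i\<in>I - X. y i))) = (\<Prod>i\<in>I. exp (y i) + exp (- y i))"
proof -
  have "exp ((\<Sum>i\<in>X. y i) - (\<Sum>i\<in>I - X. y i)) = (\<Prod>i\<in>X. exp (y i)) * (\<Prod>i\<in>I - X. exp (- y i))"
    if "X \<in> Pow I" for X
  proof -
    have "(\<Sum>i\<in>X. y i) - (\<Sum>i\<in>I - X. y i) = (\<Sum>i\<in>X. y i) + (\<Sum>i\<in>I - X. - y i)"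
      by (simp add: sum_negf)
    then show ?thesis
      using that I finite_subset[of X I] by (simp only: exp_add exp_sum finite_Diff Pow_iff)
  qed
  then show ?thesis
    by (simp add: prod_add[OF I])
qed

text \<open>
  After scaling to \<open>s = 1\<close>, the moment generating function of the random sum \<open>S\<close> is a product of
  hyperbolic cosines, at most \<open>exp (\<Sum> y\<^sup>2) \<le> exp 1\<close>, and \<open>\<bar>S\<bar>\<^sup>p\<close> is dominated by
  \<open>p\<^sup>p (exp S + exp (- S))\<close>. Leaving \<open>s\<close> free, instead of taking the exact square function, avoids
  division by zero and lets \<open>s\<close> be the quantity needed below.
\<close>

lemma Khintchine_upper:
  fixes y :: "'i \<Rightarrow> real"
  assumes I: "finite I" and p: "1 \<le> p" and s: "0 < s" and y: "(\<Sum>i\<in>I. (y i)\<^sup>2) \<le> s\<^sup>2"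
  shows "(\<Sum>X\<in>Pow I. \<bar>(\<Sum>i\<in>X. y i) - (\<Sum>i\<in>I - X. y i)\<bar> powr p)
    \<le> 2 ^ card I * (2 * p powr p * exp 1) * s powr p"
proof -
  define z where "z i = y i / s" for i
  define S where "S X = (\<Sum>i\<in>X. z i) - (\<Sum>i\<in>I - X. z i)" for X
  have z_sum: "(\<Sum>i\<in>I. (z i)\<^sup>2) \<le> 1"
    using y s by (simp add: z_def power_divide flip: sum_divide_distrib)
  have z1: "\<bar>z i\<bar> \<le> 1" if "i \<in> I" for i
  proof -
    have "(z i)\<^sup>2 \<le> 1"
      using member_le_sum[of i I "\<lambda>i. (z i)\<^sup>2"] that I z_sum by simp
    then show ?thesis
      by (simp add: abs_square_le_1)
  qed
  have prod: "(\<Prod>i\<in>I. exp (z i) + exp (- z i)) \<le> 2 ^ card I * exp 1"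
  proof -
    have "(\<Prod>i\<in>I. exp (z i) + exp (- z i)) \<le> (\<Prod>i\<in>I. 2 * exp ((z i)\<^sup>2))"
      using z1 by (intro prod_mono) (auto intro: exp_plus_exp_minus_le add_nonneg_nonneg)
    also have "\<dots> = 2 ^ card I * exp (\<Sum>i\<in>I. (z i)\<^sup>2)"
      by (simp add: prod.distrib exp_sum I)
    finally show ?thesis
      using z_sum by (elim order_trans) simp
  qed
  have "(\<Sum>X\<in>Pow I. \<bar>S X\<bar> powr p) \<le> (\<Sum>X\<in>Pow I. p powr p * (exp (S X) + exp (- S X)))"
  proof (rule sum_mono)
    fix X
    have "\<bar>S X\<bar> powr p \<le> p powr p * exp \<bar>S X\<bar>"
      using p by (intro powr_le_exp) auto
    also have "\<dots> \<le> p powr p * (exp (S X) + exp (- S X))"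
      by (intro mult_left_mono) (auto simp: abs_if add_increasing add_increasing2)
    finally show "\<bar>S X\<bar> powr p \<le> p powr p * (exp (S X) + exp (- S X))" .
  qed
  also have "\<dots> = p powr p * ((\<Sum>X\<in>Pow I. exp (S X)) + (\<Sum>X\<in>Pow I. exp (- S X)))"
    by (simp add: sum.distrib flip: sum_distrib_left)
  also have "(\<Sum>X\<in>Pow I. exp (S X)) = (\<Prod>i\<in>I. exp (z i) + exp (- z i))"
    unfolding S_def by (rule sum_exp_signed_sums[OF I])
  also have "(\<Sum>X\<in>Pow I. exp (- S X)) = (\<Prod>i\<in>I. exp (z i) + exp (- z i))"
    using sum_exp_signed_sums[OF I, of "\<lambda>i. - z i"] by (simp add: S_def sum_negf add.commute)
  also have "p powr p * ((\<Prod>i\<in>I. exp (z i) + exp (- z i)) + (\<Prod>i\<in>I. exp (z i) + exp (- z i)))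
      \<le> p powr p * (2 ^ card I * exp 1 + 2 ^ card I * exp 1)"
    by (intro mult_left_mono add_mono prod) auto
  finally have main: "(\<Sum>X\<in>Pow I. \<bar>S X\<bar> powr p) \<le> 2 ^ card I * (2 * p powr p * exp 1)"
    by (simp add: mult_ac)
  have "\<bar>(\<Sum>i\<in>X. y i) - (\<Sum>i\<in>I - X. y i)\<bar> powr p = \<bar>S X\<bar> powr p * s powr p" for X
  proof -
    have "(\<Sum>i\<in>X. y i) - (\<Sum>i\<in>I - X. y i) = S X * s"
      using s by (simp add: S_def z_def left_diff_distrib flip: sum_divide_distrib)
    then show ?thesis
      using s by (simp add: abs_mult powr_mult)
  qed
  then show ?thesis
    using main s by (simp add: mult_right_mono flip: sum_distrib_right)
qed

text \<open>
  The square function lies below the geometric mean of the \<open>\<ell>\<^sub>1\<close>- and the \<open>\<ell>\<^sub>p\<close>-norm, because \<open>max \<bar>y\<bar>\<close>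
  is at most the \<open>\<ell>\<^sub>p\<close>-norm. The parameter \<open>d\<close> makes the \<open>\<ell>\<^sub>1\<close>-term as small as required.
\<close>

lemma signed_sums_average_le:
  fixes y :: "'i \<Rightarrow> real"
  assumes I: "finite I" and p: "1 \<le> p" and d: "0 < d"
  shows "(\<Sum>X\<in>Pow I. \<bar>(\<Sum>i\<in>X. y i) - (\<Sum>i\<in>I - X. y i)\<bar> powr p)
    \<le> 2 ^ card I * (2 * p powr p * exp 1) *
      (d * (\<Sum>i\<in>I. \<bar>y i\<bar>) powr p + (\<Sum>i\<in>I. \<bar>y i\<bar> powr p) / d)"
proof (cases "\<forall>i\<in>I. y i = 0")
  case True
  then have "(\<Sum>i\<in>X. y i) - (\<Sum>i\<in>I - X. y i) = 0" if "X \<in> Pow I" for X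
    using that by (simp add: subset_iff)
  then show ?thesis
    using True by simp
next
  case False
  define S1 where "S1 = (\<Sum>i\<in>I. \<bar>y i\<bar>)"
  define T where "T = (\<Sum>i\<in>I. \<bar>y i\<bar> powr p)"
  define s where "s = sqrt (T powr (1 / p) * S1)"
  obtain j where j: "j \<in> I" "y j \<noteq> 0"
    using False by blast
  have S1: "0 < S1"
    unfolding S1_def using j I by (intro sum_pos2[of I j]) auto
  have T: "0 < T"
    unfolding T_def using j I by (intro sum_pos2[of I j]) auto
  have s: "0 < s"
    using S1 T by (simp add: s_def)
  have le: "\<bar>y i\<bar> \<le> T powr (1 / p)" if "i \<in> I" for i
  proof -
    have "\<bar>y i\<bar> = (\<bar>y i\<bar> powr p) powr (1 / p)"
      using p by (simp add: powr_powr)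
    also have "\<dots> \<le> T powr (1 / p)"
      unfolding T_def using that I p by (intro powr_mono2 member_le_sum) auto
    finally show ?thesis .
  qed
  have "(\<Sum>i\<in>I. (y i)\<^sup>2) \<le> (\<Sum>i\<in>I. T powr (1 / p) * \<bar>y i\<bar>)"
  proof (rule sum_mono)
    fix i
    assume "i \<in> I"
    then have "\<bar>y i\<bar> * \<bar>y i\<bar> \<le> T powr (1 / p) * \<bar>y i\<bar>"
      by (intro mult_right_mono le) auto
    then show "(y i)\<^sup>2 \<le> T powr (1 / p) * \<bar>y i\<bar>"
      by (simp add: power2_eq_square)
  qed
  also have "\<dots> = s\<^sup>2"
    using S1 T by (simp add: s_def S1_def flip: sum_distrib_left)
  finally have "(\<Sum>X\<in>Pow I. \<bar>(\<Sum>i\<in>X. y i) - (\<Sum>i\<in>I - X. y i)\<bar> powr p)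
      \<le> 2 ^ card I * (2 * p powr p * exp 1) * s powr p"
    by (intro Khintchine_upper I p s)
  also have "s powr p = sqrt (T * S1 powr p)"
  proof -
    have "s powr p = ((T powr (1 / p) * S1) powr p) powr (1 / 2)"
      using S1 T by (simp add: s_def powr_half_sqrt[symmetric] powr_powr mult.commute[of p])
    also have "\<dots> = (T * S1 powr p) powr (1 / 2)"
      using S1 T p by (simp add: powr_mult powr_powr)
    also have "\<dots> = sqrt (T * S1 powr p)"
      using S1 T by (intro powr_half_sqrt) auto
    finally show ?thesis .
  qed
  also have "T * S1 powr p = (d * S1 powr p) * (T / d)"
    using d by simp
  also have "sqrt \<dots> \<le> (d * S1 powr p + T / d) / 2"
    using d T by (intro arith_geo_mean_sqrt) auto
  also have "\<dots> \<le> d * S1 powr p + T / d"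
  proof -
    have "r / 2 \<le> r" if "0 \<le> r" for r :: real
      using that by simp
    then show ?thesis
      using d T by (simp only: add_nonneg_nonneg mult_nonneg_nonneg divide_nonneg_nonneg powr_ge_zero
          less_imp_le)
  qed
  finally show ?thesis
    by (simp add: S1_def T_def mult_left_mono)
qed

lemma sum_powr_le_powr_sum:
  fixes y :: "'i \<Rightarrow> real"
  assumes I: "finite I" and p: "1 \<le> p"
  shows "(\<Sum>i\<in>I. \<bar>y i\<bar> powr p) \<le> (\<Sum>i\<in>I. \<bar>y i\<bar>) powr p"
proof -
  define S where "S = (\<Sum>i\<in>I. \<bar>y i\<bar>)"
  have split: "r powr p = r powr (p - 1) * r" if "0 \<le> r" for r :: real
    using that powr_add[of r "p - 1" 1] by simp
  have "(\<Sum>i\<in>I. \<bar>y i\<bar> powr p) \<le> (\<Sum>i\<in>I. S powr (p - 1) * \<bar>y i\<bar>)"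
  proof (rule sum_mono)
    fix i
    assume "i \<in> I"
    then have "\<bar>y i\<bar> \<le> S"
      unfolding S_def using I by (intro member_le_sum) auto
    then show "\<bar>y i\<bar> powr p \<le> S powr (p - 1) * \<bar>y i\<bar>"
      using p by (subst split) (auto intro!: mult_right_mono powr_mono2)
  qed
  also have "\<dots> = S powr p"
    by (subst split) (auto simp: S_def sum_nonneg simp flip: sum_distrib_left)
  finally show ?thesis
    by (simp add: S_def)
qed

section \<open>The unconditional constant\<close>

context Lp_exponent
begin

lemma Lp_sums_add_scaled:
  assumes y: "Lp_sums M p y f" and z: "Lp_sums M p z g"
  shows "Lp_sums M p (\<lambda>n t. y n t + c * z n t) (\<lambda>t. f t + c * g t)"
proof -
  have yL: "\<And>n. y n \<in> Lp_space M p" "f \<in> Lp_space M p"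
    and zL: "\<And>n. z n \<in> Lp_space M p" "g \<in> Lp_space M p"
    using y z by (auto simp: Lp_sums_def)
  define F where "F N t = f t - (\<Sum>n<N. y n t)" for N t
  define G where "G N t = g t - (\<Sum>n<N. z n t)" for N t
  have FG: "F N \<in> Lp_space M p" "G N \<in> Lp_space M p" for N
    unfolding F_def[abs_def] G_def[abs_def] by (intro Lp_diff Lp_sum yL zL)+
  have lim: "(\<lambda>N. Lp_norm M p (F N) + \<bar>c\<bar> * Lp_norm M p (G N)) \<longlonglongrightarrow> 0 + \<bar>c\<bar> * 0"
    using y z by (intro tendsto_intros) (auto simp: Lp_sums_def F_def[abs_def] G_def[abs_def])
  have "f t + c * g t - (\<Sum>n<N. y n t + c * z n t) = F N t + c * G N t" for N t
    by (simp add: F_def G_def sum.distrib sum_distrib_left algebra_simps)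
  then have "(\<lambda>N. Lp_norm M p (\<lambda>t. f t + c * g t - (\<Sum>n<N. y n t + c * z n t))) \<longlonglongrightarrow> 0"
    using Lp_add_scaled(2)[OF FG] lim
    by (intro tendsto_sandwich[OF _ _ tendsto_const lim[simplified]])
      (auto intro!: always_eventually simp: Lp_norm_nonneg)
  then show ?thesis
    using Lp_add_scaled(1) yL zL by (auto simp: Lp_sums_def)
qed

lemma Lp_sums_in_closed_span:
  assumes "Lp_sums M p (\<lambda>n t. a n * x n t) f"
  shows "f \<in> Lp_closed_span M p x"
proof -
  have "\<exists>N a. Lp_norm M p (\<lambda>t. f t - (\<Sum>n<N. a n * x n t)) < e" if "0 < e" for e
    using assms order_tendstoD(2)[of _ 0 sequentially e] that
    by (fastforce simp: Lp_sums_def eventually_sequentially)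
  then show ?thesis
    using assms by (auto simp: Lp_sums_def Lp_closed_span_def)
qed

lemma Lp_closed_span_limit:
  assumes f: "f \<in> Lp_space M p" and x: "\<And>n. x n \<in> Lp_space M p"
    and F: "\<And>m. F m \<in> Lp_closed_span M p x" "(\<lambda>m. Lp_norm M p (\<lambda>t. f t - F m t)) \<longlonglongrightarrow> 0"
  shows "f \<in> Lp_closed_span M p x"
proof -
  have FL: "F m \<in> Lp_space M p" for m
    using F(1) by (auto simp: Lp_closed_span_def)
  have "\<exists>N a. Lp_norm M p (\<lambda>t. f t - (\<Sum>n<N. a n * x n t)) < e" if e: "0 < e" for e
  proof -
    obtain m where m: "Lp_norm M p (\<lambda>t. f t - F m t) < e / 2"
      using order_tendstoD(2)[OF F(2), of "e / 2"] e by (auto simp: eventually_sequentially)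
    have "\<forall>e>0. \<exists>N a. Lp_norm M p (\<lambda>t. F m t - (\<Sum>n<N. a n * x n t)) < e"
      using F(1)[of m] by (simp add: Lp_closed_span_def)
    then obtain N a where Na: "Lp_norm M p (\<lambda>t. F m t - (\<Sum>n<N. a n * x n t)) < e / 2"
      using e half_gt_zero by blast
    have "Lp_norm M p (\<lambda>t. (f t - F m t) + (F m t - (\<Sum>n<N. a n * x n t))) \<le>
        Lp_norm M p (\<lambda>t. f t - F m t) + Lp_norm M p (\<lambda>t. F m t - (\<Sum>n<N. a n * x n t))"
      by (intro Lp_add Lp_diff Lp_sum Lp_scale f FL x)
    then have "Lp_norm M p (\<lambda>t. f t - (\<Sum>n<N. a n * x n t)) < e"
      using m Na by simp
    then show ?thesis
      by blast
  qed
  then show ?thesis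
    using f by (simp add: Lp_closed_span_def)
qed

text \<open>
  Countable subadditivity of the lattice norm of coefficient sequences, at a fixed truncation \<open>N\<close>.
\<close>

lemma Lp_norm_superposition_le:
  assumes x: "\<And>n. x n \<in> Lp_space M p"
    and c: "\<And>n. (\<lambda>k. c k n) sums d n"
    and r: "summable r" "\<And>k. Lp_norm M p (\<lambda>t. \<Sum>n<N. \<bar>c k n * x n t\<bar>) \<le> r k"
  shows "Lp_norm M p (\<lambda>t. \<Sum>n<N. \<bar>d n * x n t\<bar>) \<le> (\<Sum>k. r k)"
proof -
  have meas[measurable]: "x n \<in> borel_measurable M" for n
    using x by (rule Lp_space_measurable)
  have termL: "(\<lambda>t. \<Sum>n<N. \<bar>b n * x n t\<bar>) \<in> Lp_space M p" for b
    by (intro Lp_sum Lp_abs Lp_scale x)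
  have r0: "0 \<le> r k" for k
    using r(2)[of k] Lp_norm_nonneg order_trans by blast
  have "(\<lambda>t. \<Sum>n<N. \<bar>d n * x n t\<bar>) \<in> Lp_space M p \<and>
      Lp_norm M p (\<lambda>t. \<Sum>n<N. \<bar>d n * x n t\<bar>) \<le> (\<Sum>k. r k)"
  proof (rule Lp_norm_Fatou[where u = "\<lambda>j t. \<Sum>n<N. \<bar>(\<Sum>k<j. c k n) * x n t\<bar>"])
    show "(\<lambda>t. \<Sum>n<N. \<bar>(\<Sum>k<j. c k n) * x n t\<bar>) \<in> Lp_space M p" for j
      by (rule termL)
    show "0 \<le> (\<Sum>k. r k)"
      using r r0 by (intro suminf_nonneg)
    show "Lp_norm M p (\<lambda>t. \<Sum>n<N. \<bar>(\<Sum>k<j. c k n) * x n t\<bar>) \<le> (\<Sum>k. r k)" for j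
    proof -
      have dom: "(\<lambda>t. \<Sum>k<j. \<Sum>n<N. \<bar>c k n * x n t\<bar>) \<in> Lp_space M p"
        by (intro Lp_sum termL)
      have "Lp_norm M p (\<lambda>t. \<Sum>n<N. \<bar>(\<Sum>k<j. c k n) * x n t\<bar>) \<le>
          Lp_norm M p (\<lambda>t. \<Sum>k<j. \<Sum>n<N. \<bar>c k n * x n t\<bar>)"
      proof (rule conjunct2[OF Lp_dominated])
        have "(\<Sum>n<N. \<bar>(\<Sum>k<j. c k n) * x n t\<bar>) \<le> (\<Sum>k<j. \<Sum>n<N. \<bar>c k n * x n t\<bar>)" for t
          by (subst sum.swap) (auto simp: sum_distrib_right intro!: sum_mono sum_abs)
        then show "AE t in M. \<bar>\<Sum>n<N. \<bar>(\<Sum>k<j. c k n) * x n t\<bar>\<bar> \<le> \<bar>\<Sum>k<j. \<Sum>n<N. \<bar>c k n * x n t\<bar>\<bar>"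
          by (simp add: sum_nonneg)
      qed (use dom in auto)
      also have "\<dots> \<le> (\<Sum>k<j. Lp_norm M p (\<lambda>t. \<Sum>n<N. \<bar>c k n * x n t\<bar>))"
        by (intro Lp_sum termL)
      also have "\<dots> \<le> (\<Sum>k<j. r k)"
        by (intro sum_mono r)
      also have "\<dots> \<le> (\<Sum>k. r k)"
        using r r0 by (intro sum_le_suminf) auto
      finally show ?thesis .
    qed
    show "AE t in M. (\<lambda>j. \<Sum>n<N. \<bar>(\<Sum>k<j. c k n) * x n t\<bar>) \<longlonglongrightarrow> (\<Sum>n<N. \<bar>d n * x n t\<bar>)"
      using c by (intro always_eventually allI tendsto_intros) (simp add: sums_def)
  qed measurable
  then show ?thesis
    by simp
qed

end

locale normalized_nonneg_unconditional_sequence = Lp_exponent +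
  fixes x :: "nat \<Rightarrow> 'a \<Rightarrow> real"
  assumes basic: "Lp_unconditionally_basic M p x"
    and normalized: "\<And>n. Lp_norm M p (x n) = 1"
    and nonneg: "\<And>n. AE t in M. 0 \<le> x n t"
begin

text \<open>
  The basis coefficients; the definite description denotes them on the closed span only.
\<close>

definition coef :: "('a \<Rightarrow> real) \<Rightarrow> nat \<Rightarrow> real" where
  "coef f = (THE a. Lp_sums M p (\<lambda>n t. a n * x n t) f)"

definition lattice_norm :: "('a \<Rightarrow> real) \<Rightarrow> real" where
  "lattice_norm f = (SUP N. Lp_norm M p (\<lambda>t. \<Sum>n<N. \<bar>coef f n * x n t\<bar>))"

abbreviation V :: "('a \<Rightarrow> real) set" where
  "V \<equiv> Lp_closed_span M p x"

lemma x_Lp: "x n \<in> Lp_space M p"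
  using basic by (simp add: Lp_unconditionally_basic_def)

lemma V_Lp: "f \<in> V \<Longrightarrow> f \<in> Lp_space M p"
  by (simp add: Lp_closed_span_def)

lemma abs_sum_Lp: "(\<lambda>t. \<Sum>n<N. \<bar>b n * x n t\<bar>) \<in> Lp_space M p"
  by (intro Lp_sum Lp_abs Lp_scale x_Lp)

lemma ex1_coef: "f \<in> V \<Longrightarrow> \<exists>!a. Lp_sums M p (\<lambda>n t. a n * x n t) f"
  using basic by (simp add: Lp_unconditionally_basic_def Lp_schauder_basis_def)

lemma Lp_sums_coef: "f \<in> V \<Longrightarrow> Lp_sums M p (\<lambda>n t. coef f n * x n t) f"
  unfolding coef_def by (rule theI'[OF ex1_coef])

lemma coef_eqI: "Lp_sums M p (\<lambda>n t. a n * x n t) f \<Longrightarrow> coef f = a"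
  using ex1_coef Lp_sums_in_closed_span Lp_sums_coef by blast

lemma V_add_scaled:
  assumes "f \<in> V" "g \<in> V"
  shows "(\<lambda>t. f t + c * g t) \<in> V" "coef (\<lambda>t. f t + c * g t) = (\<lambda>n. coef f n + c * coef g n)"
proof -
  have "Lp_sums M p (\<lambda>n t. (coef f n + c * coef g n) * x n t) (\<lambda>t. f t + c * g t)"
    using Lp_sums_add_scaled[OF Lp_sums_coef[OF assms(1)] Lp_sums_coef[OF assms(2)], of c]
    by (simp add: algebra_simps)
  then show "(\<lambda>t. f t + c * g t) \<in> V" "coef (\<lambda>t. f t + c * g t) = (\<lambda>n. coef f n + c * coef g n)"
    by (auto intro: Lp_sums_in_closed_span coef_eqI)
qed

lemma finite_sum_in_V:
  fixes b :: "nat \<Rightarrow> real"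
  shows "(\<lambda>t. \<Sum>n<N. b n * x n t) \<in> V"
    "coef (\<lambda>t. \<Sum>n<N. b n * x n t) = (\<lambda>n. if n < N then b n else 0)"
proof -
  define b' where "b' n = (if n < N then b n else 0)" for n
  have "(\<Sum>n<N. b n * x n t) - (\<Sum>n<m. b' n * x n t) = 0" if "N \<le> m" for m t
  proof -
    have "(\<Sum>n<m. b' n * x n t) = (\<Sum>n<N. b' n * x n t)"
      using that by (intro sum.mono_neutral_right) (auto simp: b'_def)
    then show ?thesis
      by (simp add: b'_def)
  qed
  then have "\<forall>\<^sub>F m in sequentially.
      Lp_norm M p (\<lambda>t. (\<Sum>n<N. b n * x n t) - (\<Sum>n<m. b' n * x n t)) = 0"
    by (intro eventually_sequentiallyI[of N]) (simp add: Lp_zero)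
  then have "Lp_sums M p (\<lambda>n t. b' n * x n t) (\<lambda>t. \<Sum>n<N. b n * x n t)"
    by (auto simp: Lp_sums_def intro!: Lp_scale Lp_sum x_Lp tendsto_eventually)
  then show "(\<lambda>t. \<Sum>n<N. b n * x n t) \<in> V"
    "coef (\<lambda>t. \<Sum>n<N. b n * x n t) = (\<lambda>n. if n < N then b n else 0)"
    by (auto intro: Lp_sums_in_closed_span dest: coef_eqI simp: b'_def[abs_def])
qed

lemma V_zero: "(\<lambda>t. 0) \<in> V" "coef (\<lambda>t. 0) = (\<lambda>n. 0)"
  using finite_sum_in_V[where N = 0] by auto

text \<open>
  Finiteness of the supremum in \<open>lattice_norm\<close>: this is where unconditionality and the positivity of
  the basis meet, the latter making each term \<open>c n x n\<close> of constant sign.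
\<close>

lemma bdd_above_abs_expansion:
  assumes f: "f \<in> V"
  shows "bdd_above (range (\<lambda>N. Lp_norm M p (\<lambda>t. \<Sum>n<N. \<bar>coef f n * x n t\<bar>)))"
proof -
  have "Lp_unconditionally_summable M p (\<lambda>n t. coef f n * x n t)"
    using basic f Lp_sums_coef[OF f] by (simp add: Lp_unconditionally_basic_def)
  moreover have "(AE t in M. 0 \<le> coef f n * x n t) \<or> (AE t in M. coef f n * x n t \<le> 0)" for n
  proof (cases "0 \<le> coef f n")
    case True
    have "AE t in M. 0 \<le> coef f n * x n t"
      using nonneg[of n] by eventually_elim (use True in simp)
    then show ?thesis ..
  next
    case False
    have "AE t in M. coef f n * x n t \<le> 0"
      using nonneg[of n] by eventually_elim (use False in \<open>simp add: mult_nonpos_nonneg\<close>)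
    then show ?thesis ..
  qed
  ultimately obtain B where "\<And>N. Lp_norm M p (\<lambda>t. \<Sum>n<N. \<bar>coef f n * x n t\<bar>) \<le> B"
    using unconditionally_summable_abs_bounded by blast
  then show ?thesis
    by (rule bdd_aboveI2)
qed

lemma abs_expansion_le_lattice_norm:
  "f \<in> V \<Longrightarrow> Lp_norm M p (\<lambda>t. \<Sum>n<N. \<bar>coef f n * x n t\<bar>) \<le> lattice_norm f"
  unfolding lattice_norm_def by (intro cSUP_upper bdd_above_abs_expansion) auto

lemma lattice_norm_least:
  "(\<And>N. Lp_norm M p (\<lambda>t. \<Sum>n<N. \<bar>coef f n * x n t\<bar>) \<le> B) \<Longrightarrow> lattice_norm f \<le> B"
  unfolding lattice_norm_def by (intro cSUP_least) auto

lemma lattice_norm_nonneg: "f \<in> V \<Longrightarrow> 0 \<le> lattice_norm f"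
  using abs_expansion_le_lattice_norm[of f 0] by (simp add: Lp_zero)

lemma lattice_norm_zero: "lattice_norm (\<lambda>t. 0) = 0"
  by (simp add: lattice_norm_def V_zero Lp_zero)

lemma lattice_norm_add_scaled:
  assumes f: "f \<in> V" and g: "g \<in> V"
  shows "lattice_norm (\<lambda>t. f t + c * g t) \<le> lattice_norm f + \<bar>c\<bar> * lattice_norm g"
proof (rule lattice_norm_least)
  fix N
  let ?F = "\<lambda>t. \<Sum>n<N. \<bar>coef f n * x n t\<bar>" and ?G = "\<lambda>t. \<Sum>n<N. \<bar>coef g n * x n t\<bar>"
  have "Lp_norm M p (\<lambda>t. \<Sum>n<N. \<bar>coef (\<lambda>t. f t + c * g t) n * x n t\<bar>)
      \<le> Lp_norm M p (\<lambda>t. ?F t + \<bar>c\<bar> * ?G t)"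
  proof (rule conjunct2[OF Lp_dominated])
    have "\<bar>(coef f n + c * coef g n) * x n t\<bar> \<le> \<bar>coef f n * x n t\<bar> + \<bar>c\<bar> * \<bar>coef g n * x n t\<bar>"
      for n t
      using abs_triangle_ineq[of "coef f n * x n t" "c * (coef g n * x n t)"]
      by (simp add: algebra_simps abs_mult)
    then have "(\<Sum>n<N. \<bar>coef (\<lambda>t. f t + c * g t) n * x n t\<bar>) \<le> ?F t + \<bar>c\<bar> * ?G t" for t
      unfolding V_add_scaled(2)[OF f g] sum_distrib_left sum.distrib[symmetric]
      by (intro sum_mono)
    then show "AE t in M. \<bar>\<Sum>n<N. \<bar>coef (\<lambda>t. f t + c * g t) n * x n t\<bar>\<bar> \<le> \<bar>?F t + \<bar>c\<bar> * ?G t\<bar>"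
      by (auto intro: order_trans[OF _ abs_ge_self] simp: sum_nonneg)
    show "(\<lambda>t. \<Sum>n<N. \<bar>coef (\<lambda>t. f t + c * g t) n * x n t\<bar>) \<in> borel_measurable M"
      by (rule Lp_space_measurable[OF abs_sum_Lp])
    show "(\<lambda>t. ?F t + \<bar>c\<bar> * ?G t) \<in> Lp_space M p"
      by (intro Lp_add_scaled abs_sum_Lp)
  qed
  also have "\<dots> \<le> Lp_norm M p ?F + \<bar>\<bar>c\<bar>\<bar> * Lp_norm M p ?G"
    by (intro Lp_add_scaled abs_sum_Lp)
  also have "\<dots> \<le> lattice_norm f + \<bar>c\<bar> * lattice_norm g"
    using abs_expansion_le_lattice_norm[OF f] abs_expansion_le_lattice_norm[OF g]
    by (auto intro!: add_mono mult_left_mono)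
  finally show "Lp_norm M p (\<lambda>t. \<Sum>n<N. \<bar>coef (\<lambda>t. f t + c * g t) n * x n t\<bar>)
      \<le> lattice_norm f + \<bar>c\<bar> * lattice_norm g" .
qed

lemma abs_coef_le_lattice_norm:
  assumes f: "f \<in> V"
  shows "\<bar>coef f n\<bar> \<le> lattice_norm f"
proof -
  have "\<bar>coef f n\<bar> = Lp_norm M p (\<lambda>t. coef f n * x n t)"
    using Lp_scale(2)[OF x_Lp] normalized by simp
  also have "\<dots> \<le> Lp_norm M p (\<lambda>t. \<Sum>i<Suc n. \<bar>coef f i * x i t\<bar>)"
    by (rule conjunct2[OF Lp_dominated])
      (auto intro!: Lp_space_measurable[OF Lp_scale(1)[OF x_Lp]] abs_sum_Lp always_eventually
        simp: sum_nonneg simp del: sum.lessThan_Suc intro: member_le_sum[where f = "\<lambda>i. \<bar>coef f i * x i _\<bar>"])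
  also have "\<dots> \<le> lattice_norm f"
    by (rule abs_expansion_le_lattice_norm[OF f])
  finally show ?thesis .
qed

text \<open>
  The hypothesis of Zabreiko's lemma. Each coefficient functional is bounded by the lattice norm, as
  the basis is normalized; hence the coefficients of the \<open>u k\<close> can be summed to a sequence \<open>d\<close>.
  The point is that \<open>d\<close> expands \<open>f\<close>, so that uniqueness makes it the coefficient sequence of \<open>f\<close>
  although continuity of coefficients in \<open>\<parallel>\<cdot>\<parallel>\<^sub>p\<close> is not known yet.
\<close>

lemma lattice_norm_series:
  assumes u: "\<And>k. u k \<in> V" and f: "f \<in> V" and sum: "summable (\<lambda>k. lattice_norm (u k))"
    and lim: "(\<lambda>m. Lp_norm M p (\<lambda>t. f t - (\<Sum>k<m. u k t))) \<longlonglongrightarrow> 0"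
  shows "lattice_norm f \<le> (\<Sum>k. lattice_norm (u k))"
proof -
  define d where "d n = (\<Sum>k. coef (u k) n)" for n
  have summ: "summable (\<lambda>k. coef (u k) n)" for n
    using abs_coef_le_lattice_norm[OF u]
    by (intro summable_comparison_test'[OF sum, of 0]) auto
  then have d: "(\<lambda>k. coef (u k) n) sums d n" for n
    by (simp add: d_def summable_sums)
  have partial: "(\<lambda>t. \<Sum>k<m. u k t) \<in> V \<and>
      coef (\<lambda>t. \<Sum>k<m. u k t) = (\<lambda>n. \<Sum>k<m. coef (u k) n)" for m
  proof (induction m)
    case (Suc m)
    then show ?case
      using V_add_scaled[of "\<lambda>t. \<Sum>k<m. u k t" "u m" 1] u by simp
  qed (simp add: V_zero)
  have "Lp_sums M p (\<lambda>n t. d n * x n t) f"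
    unfolding Lp_sums_def
  proof (intro conjI allI V_Lp[OF f] Lp_scale x_Lp LIMSEQ_I)
    fix e :: real
    assume e: "0 < e"
    have "(\<lambda>m. \<Sum>k. lattice_norm (u (k + m))) \<longlonglongrightarrow> 0"
      using suminf_exist_split2[OF sum] .
    then have "\<forall>\<^sub>F m in sequentially. (\<Sum>k. lattice_norm (u (k + m))) < e / 3 \<and>
        Lp_norm M p (\<lambda>t. f t - (\<Sum>k<m. u k t)) < e / 3"
      using e lim by (intro eventually_conj order_tendstoD(2)[where y = 0]) auto
    then obtain m where m: "(\<Sum>k. lattice_norm (u (k + m))) < e / 3"
        "Lp_norm M p (\<lambda>t. f t - (\<Sum>k<m. u k t)) < e / 3"
      by (auto simp: eventually_sequentially)
    define F where "F t = (\<Sum>k<m. u k t)" for t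
    have F: "F \<in> V" "coef F = (\<lambda>n. \<Sum>k<m. coef (u k) n)"
      using partial[of m] by (auto simp: F_def[abs_def])
    have FL: "F \<in> Lp_space M p"
      by (rule V_Lp[OF F(1)])
    have "(\<lambda>N. Lp_norm M p (\<lambda>t. F t - (\<Sum>n<N. coef F n * x n t))) \<longlonglongrightarrow> 0"
      using Lp_sums_coef[OF F(1)] by (simp add: Lp_sums_def)
    from order_tendstoD(2)[OF this, of "e / 3"] e
    obtain N0 where N0: "\<And>N. N0 \<le> N \<Longrightarrow> Lp_norm M p (\<lambda>t. F t - (\<Sum>n<N. coef F n * x n t)) < e / 3"
      by (auto simp: eventually_sequentially)
    have "Lp_norm M p (\<lambda>t. f t - (\<Sum>n<N. d n * x n t)) < e" if N: "N0 \<le> N" for N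
    proof -
      \<comment> \<open>\<open>A\<close>: tail of \<open>\<Sum> u k\<close>; \<open>B\<close>: remainder of the expansion of the head \<open>F\<close>; \<open>D\<close>: the part of
        the expansion by \<open>d\<close> that comes from the tail.\<close>
      define A where "A t = f t - F t" for t
      define B where "B t = F t - (\<Sum>n<N. coef F n * x n t)" for t
      define D where "D t = (\<Sum>n<N. (d n - coef F n) * x n t)" for t
      have L: "A \<in> Lp_space M p" "B \<in> Lp_space M p" "D \<in> Lp_space M p"
        unfolding A_def[abs_def] B_def[abs_def] D_def[abs_def]
        by (intro Lp_diff Lp_sum Lp_scale FL V_Lp[OF f] x_Lp)+
      have tail: "(\<lambda>k. coef (u (k + m)) n) sums (d n - coef F n)" for n
        unfolding F(2) by (intro sums_split_initial_segment d)
      have "Lp_norm M p D \<le> Lp_norm M p (\<lambda>t. \<Sum>n<N. \<bar>(d n - coef F n) * x n t\<bar>)"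
        using L(3)[THEN Lp_space_measurable]
        by (intro conjunct2[OF Lp_dominated] abs_sum_Lp) (auto simp: D_def sum_nonneg intro!: sum_abs)
      also have "\<dots> \<le> (\<Sum>k. lattice_norm (u (k + m)))"
        by (rule Lp_norm_superposition_le[where c = "\<lambda>k. coef (u (k + m))", OF x_Lp tail
              summable_ignore_initial_segment[OF sum] abs_expansion_le_lattice_norm[OF u]])
      also have "\<dots> < e / 3"
        by (rule m)
      finally have D: "Lp_norm M p D < e / 3" .
      have "f t - (\<Sum>n<N. d n * x n t) = A t + B t - D t" for t
        by (simp add: A_def B_def D_def left_diff_distrib sum_subtractf)
      then have "Lp_norm M p (\<lambda>t. f t - (\<Sum>n<N. d n * x n t)) = Lp_norm M p (\<lambda>t. A t + B t - D t)"
        by simp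
      also have "\<dots> \<le> Lp_norm M p (\<lambda>t. A t + B t) + Lp_norm M p D"
        by (intro Lp_diff Lp_add L)
      also have "\<dots> \<le> Lp_norm M p A + Lp_norm M p B + Lp_norm M p D"
        by (intro add_right_mono Lp_add L)
      also have "\<dots> < e"
        using D N0[OF N] m(2) by (simp add: A_def[abs_def] B_def[abs_def] F_def[abs_def])
      finally show ?thesis .
    qed
    then show "\<exists>N0. \<forall>N\<ge>N0. norm (Lp_norm M p (\<lambda>t. f t - (\<Sum>n<N. d n * x n t)) - 0) < e"
      using Lp_norm_nonneg by (intro exI[of _ N0]) auto
  qed
  then have coef_f: "coef f = d"
    by (rule coef_eqI)
  show ?thesis
  proof (rule lattice_norm_least)
    fix N
    show "Lp_norm M p (\<lambda>t. \<Sum>n<N. \<bar>coef f n * x n t\<bar>) \<le> (\<Sum>k. lattice_norm (u k))"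
      unfolding coef_f
      by (rule Lp_norm_superposition_le[OF x_Lp d sum abs_expansion_le_lattice_norm[OF u]])
  qed
qed

lemma V_complete:
  assumes u: "\<And>k. u k \<in> V" and sum: "summable (\<lambda>k. Lp_norm M p (u k))"
  shows "\<exists>f\<in>V. (\<lambda>m. Lp_norm M p (\<lambda>t. f t - (\<Sum>k<m. u k t))) \<longlonglongrightarrow> 0"
proof -
  obtain f where f: "f \<in> Lp_space M p"
      "\<And>m. Lp_norm M p (\<lambda>t. f t - (\<Sum>k<m. u k t)) \<le> (\<Sum>k. Lp_norm M p (u (k + m)))"
    using Lp_series_converges[OF V_Lp[OF u] sum] by metis
  have lim: "(\<lambda>m. Lp_norm M p (\<lambda>t. f t - (\<Sum>k<m. u k t))) \<longlonglongrightarrow> 0"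
    using f(2) by (intro tendsto_sandwich[OF _ _ tendsto_const suminf_exist_split2[OF sum]])
      (auto simp: Lp_norm_nonneg)
  have "(\<lambda>t. \<Sum>k<m. u k t) \<in> V" for m
  proof (induction m)
    case (Suc m)
    then show ?case
      using V_add_scaled(1)[of _ "u m" 1] u by simp
  qed (simp add: V_zero)
  from Lp_closed_span_limit[OF f(1) x_Lp this lim] lim show ?thesis
    by blast
qed

text \<open>
  Applied to finite sums, whose coefficients are known, boundedness of the lattice norm is the
  inequality of the unconditional constant. Only \<open>\<bar>b n\<bar>\<close> enters on the left, so it holds for all
  choices of signs on the right.
\<close>

lemma unconditional_constant:
  obtains K where "1 \<le> K"
    "\<And>N b. Lp_norm M p (\<lambda>t. \<Sum>n<N. \<bar>b n * x n t\<bar>) \<le> K * Lp_norm M p (\<lambda>t. \<Sum>n<N. b n * x n t)"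
proof -
  have "\<exists>K. \<forall>f\<in>V. lattice_norm f \<le> K * Lp_norm M p f"
    by (rule complete_norm_dominates_countably_subadditive[OF V_zero(1) V_add_scaled(1)
          Lp_norm_nonneg Lp_zero(2) Lp_add_scaled(2)[OF V_Lp V_Lp] lattice_norm_nonneg
          lattice_norm_zero lattice_norm_add_scaled V_complete lattice_norm_series])
  then obtain K where K: "\<And>f. f \<in> V \<Longrightarrow> lattice_norm f \<le> K * Lp_norm M p f"
    by blast
  have "Lp_norm M p (\<lambda>t. \<Sum>n<N. \<bar>b n * x n t\<bar>) \<le> max 1 K * Lp_norm M p (\<lambda>t. \<Sum>n<N. b n * x n t)"
    for N b
  proof -
    have "Lp_norm M p (\<lambda>t. \<Sum>n<N. \<bar>b n * x n t\<bar>) \<le> lattice_norm (\<lambda>t. \<Sum>n<N. b n * x n t)"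
      using abs_expansion_le_lattice_norm[OF finite_sum_in_V(1)[of b N], of N]
      by (simp add: finite_sum_in_V(2))
    also have "\<dots> \<le> K * Lp_norm M p (\<lambda>t. \<Sum>n<N. b n * x n t)"
      by (intro K finite_sum_in_V)
    also have "\<dots> \<le> max 1 K * Lp_norm M p (\<lambda>t. \<Sum>n<N. b n * x n t)"
      by (intro mult_right_mono Lp_norm_nonneg) auto
    finally show ?thesis .
  qed
  then show ?thesis
    using that[of "max 1 K"] by simp
qed

section \<open>Comparison with \<open>\<ell>\<^sub>p\<close>\<close>

lemma integral_sum_powr:
  "integrable M (\<lambda>t. \<Sum>n<N. \<bar>a n * x n t\<bar> powr p)"
  "(\<integral>t. (\<Sum>n<N. \<bar>a n * x n t\<bar> powr p) \<partial>M) = (\<Sum>n<N. \<bar>a n\<bar> powr p)"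
proof -
  have int: "integrable M (\<lambda>t. \<bar>a n * x n t\<bar> powr p)" for n
    using Lp_scale(1)[OF x_Lp] by (simp add: Lp_space_def)
  then show "integrable M (\<lambda>t. \<Sum>n<N. \<bar>a n * x n t\<bar> powr p)"
    by simp
  have "(\<integral>t. \<bar>a n * x n t\<bar> powr p \<partial>M) = \<bar>a n\<bar> powr p" for n
    using Lp_norm_powr[of "\<lambda>t. a n * x n t"] Lp_scale(2)[OF x_Lp, of "a n" n] normalized by simp
  then show "(\<integral>t. (\<Sum>n<N. \<bar>a n * x n t\<bar> powr p) \<partial>M) = (\<Sum>n<N. \<bar>a n\<bar> powr p)"
    using int by simp
qed

lemma lp_le_abs_sum:
  "(\<Sum>n<N. \<bar>a n\<bar> powr p) \<le> Lp_norm M p (\<lambda>t. \<Sum>n<N. \<bar>a n * x n t\<bar>) powr p"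
proof -
  have "(\<Sum>n<N. \<bar>a n\<bar> powr p) = (\<integral>t. (\<Sum>n<N. \<bar>a n * x n t\<bar> powr p) \<partial>M)"
    by (simp add: integral_sum_powr)
  also have "\<dots> \<le> (\<integral>t. \<bar>\<Sum>n<N. \<bar>a n * x n t\<bar>\<bar> powr p \<partial>M)"
  proof (rule integral_mono[OF integral_sum_powr(1)])
    show "integrable M (\<lambda>t. \<bar>\<Sum>n<N. \<bar>a n * x n t\<bar>\<bar> powr p)"
      using abs_sum_Lp by (simp add: Lp_space_def)
    show "(\<Sum>n<N. \<bar>a n * x n t\<bar> powr p) \<le> \<bar>\<Sum>n<N. \<bar>a n * x n t\<bar>\<bar> powr p" for t
      using sum_powr_le_powr_sum[OF _ p, of "{..<N}" "\<lambda>n. a n * x n t"] by (simp add: sum_nonneg)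
  qed
  finally show ?thesis
    by (simp add: Lp_norm_powr)
qed

text \<open>
  Average the unconditionality inequality over all signs, estimate the average pointwise, and choose
  \<open>d\<close> so that the \<open>\<ell>\<^sub>1\<close>-term returns with factor \<open>1/2\<close> and can be absorbed.
\<close>

lemma abs_sum_le_lp:
  assumes K: "1 \<le> K"
    "\<And>N b. Lp_norm M p (\<lambda>t. \<Sum>n<N. \<bar>b n * x n t\<bar>) \<le> K * Lp_norm M p (\<lambda>t. \<Sum>n<N. b n * x n t)"
  defines "L \<equiv> K powr p * (2 * p powr p * exp 1)"
  shows "Lp_norm M p (\<lambda>t. \<Sum>n<N. \<bar>a n * x n t\<bar>) powr p \<le> 4 * L\<^sup>2 * (\<Sum>n<N. \<bar>a n\<bar> powr p)"
proof -
  define A where "A = Lp_norm M p (\<lambda>t. \<Sum>n<N. \<bar>a n * x n t\<bar>) powr p"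
  define T where "T = (\<Sum>n<N. \<bar>a n\<bar> powr p)"
  define S where "S X t = (\<Sum>n\<in>X. a n * x n t) - (\<Sum>n\<in>{..<N} - X. a n * x n t)" for X t
  define d where "d = 1 / (2 * L)"
  have L: "0 < L"
    using K(1) p by (simp add: L_def)
  then have d: "0 < d"
    by (simp add: d_def)
  have SL: "S X \<in> Lp_space M p" for X
    unfolding S_def[abs_def] by (intro Lp_diff Lp_sum Lp_scale x_Lp)
  have intS: "integrable M (\<lambda>t. \<bar>S X t\<bar> powr p)" for X
    using SL[of X] by (simp add: Lp_space_def)
  have intA: "integrable M (\<lambda>t. (\<Sum>n<N. \<bar>a n * x n t\<bar>) powr p)"
    using abs_sum_Lp[of a N] by (simp add: Lp_space_def sum_nonneg)
  have A_int: "A = (\<integral>t. (\<Sum>n<N. \<bar>a n * x n t\<bar>) powr p \<partial>M)"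
    by (simp add: A_def Lp_norm_powr sum_nonneg)
  have sign: "A \<le> K powr p * (\<integral>t. \<bar>S X t\<bar> powr p \<partial>M)" if X: "X \<in> Pow {..<N}" for X
  proof -
    define b where "b n = (if n \<in> X then a n else - a n)" for n
    have "(\<Sum>n<N. b n * x n t) = S X t" for t
    proof -
      have "(\<Sum>n<N. b n * x n t) = (\<Sum>n\<in>X. b n * x n t) + (\<Sum>n\<in>{..<N} - X. b n * x n t)"
        using X by (simp add: sum.subset_diff[of X "{..<N}"] add.commute)
      then show ?thesis
        by (simp add: S_def b_def sum_negf)
    qed
    moreover have "\<bar>b n * x n t\<bar> = \<bar>a n * x n t\<bar>" for n t
      by (simp add: b_def)
    ultimately have "Lp_norm M p (\<lambda>t. \<Sum>n<N. \<bar>a n * x n t\<bar>) \<le> K * Lp_norm M p (S X)"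
      using K(2)[of b N] by simp
    then have "A \<le> (K * Lp_norm M p (S X)) powr p"
      unfolding A_def using p by (intro powr_mono2 Lp_norm_nonneg) auto
    also have "\<dots> = K powr p * (\<integral>t. \<bar>S X t\<bar> powr p \<partial>M)"
      using K(1) by (simp add: powr_mult Lp_norm_nonneg Lp_norm_powr)
    finally show ?thesis .
  qed
  have "2 ^ N * A = (\<Sum>X\<in>Pow {..<N}. A)"
    by (simp add: card_Pow)
  also have "\<dots> \<le> (\<Sum>X\<in>Pow {..<N}. K powr p * (\<integral>t. \<bar>S X t\<bar> powr p \<partial>M))"
    by (intro sum_mono sign)
  also have "\<dots> = K powr p * (\<integral>t. (\<Sum>X\<in>Pow {..<N}. \<bar>S X t\<bar> powr p) \<partial>M)"
    using intS by (simp flip: sum_distrib_left)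
  also have "\<dots> \<le> K powr p * (\<integral>t. 2 ^ N * (2 * p powr p * exp 1) *
      (d * (\<Sum>n<N. \<bar>a n * x n t\<bar>) powr p + (\<Sum>n<N. \<bar>a n * x n t\<bar> powr p) / d) \<partial>M)"
  proof (intro mult_left_mono integral_mono)
    show "(\<Sum>X\<in>Pow {..<N}. \<bar>S X t\<bar> powr p) \<le> 2 ^ N * (2 * p powr p * exp 1) *
        (d * (\<Sum>n<N. \<bar>a n * x n t\<bar>) powr p + (\<Sum>n<N. \<bar>a n * x n t\<bar> powr p) / d)" for t
      using signed_sums_average_le[OF _ p d, of "{..<N}" "\<lambda>n. a n * x n t"] by (simp add: S_def)
  qed (use intS intA integral_sum_powr(1)[of a N] in auto)
  also have "\<dots> = K powr p * (2 ^ N * (2 * p powr p * exp 1) * (d * A + T / d))"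
    using intA integral_sum_powr[of a N] by (simp add: A_int T_def)
  also have "\<dots> = 2 ^ N * (L * (d * A + T / d))"
    by (simp add: L_def mult_ac)
  finally have "A \<le> L * (d * A + T / d)"
    by simp
  also have "\<dots> = A / 2 + 2 * L\<^sup>2 * T"
    using L by (simp add: d_def field_simps power2_eq_square)
  finally show ?thesis
    by (simp add: A_def T_def)
qed

theorem equivalent_to_lp:
  "\<exists>c C. 0 < c \<and> c \<le> C \<and>
    (\<forall>(N::nat) (a :: nat \<Rightarrow> real).
       c * (\<Sum>n<N. \<bar>a n\<bar> powr p) powr (1 / p) \<le> Lp_norm M p (\<lambda>t. \<Sum>n<N. a n * x n t) \<and>
       Lp_norm M p (\<lambda>t. \<Sum>n<N. a n * x n t) \<le> C * (\<Sum>n<N. \<bar>a n\<bar> powr p) powr (1 / p))"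
proof -
  obtain K where K: "1 \<le> K"
    "\<And>N b. Lp_norm M p (\<lambda>t. \<Sum>n<N. \<bar>b n * x n t\<bar>) \<le> K * Lp_norm M p (\<lambda>t. \<Sum>n<N. b n * x n t)"
    using unconditional_constant by blast
  define L where "L = K powr p * (2 * p powr p * exp 1)"
  define C where "C = (4 * L\<^sup>2) powr (1 / p)"
  have lower: "1 / K * (\<Sum>n<N. \<bar>a n\<bar> powr p) powr (1 / p) \<le> Lp_norm M p (\<lambda>t. \<Sum>n<N. a n * x n t)"
    for N a
  proof -
    have "(\<Sum>n<N. \<bar>a n\<bar> powr p) powr (1 / p)
        \<le> (Lp_norm M p (\<lambda>t. \<Sum>n<N. \<bar>a n * x n t\<bar>) powr p) powr (1 / p)"
      using p by (intro powr_mono2 lp_le_abs_sum) (auto simp: sum_nonneg)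
    also have "\<dots> = Lp_norm M p (\<lambda>t. \<Sum>n<N. \<bar>a n * x n t\<bar>)"
      using p by (simp add: powr_powr Lp_norm_nonneg)
    also have "\<dots> \<le> K * Lp_norm M p (\<lambda>t. \<Sum>n<N. a n * x n t)"
      by (rule K)
    finally show ?thesis
      using K(1) by (simp add: field_simps)
  qed
  have upper: "Lp_norm M p (\<lambda>t. \<Sum>n<N. a n * x n t) \<le> C * (\<Sum>n<N. \<bar>a n\<bar> powr p) powr (1 / p)"
    for N a
  proof -
    have "(\<lambda>t. \<Sum>n<N. a n * x n t) \<in> Lp_space M p"
      by (intro Lp_sum Lp_scale x_Lp)
    from Lp_space_measurable[OF this]
    have "Lp_norm M p (\<lambda>t. \<Sum>n<N. a n * x n t) \<le> Lp_norm M p (\<lambda>t. \<Sum>n<N. \<bar>a n * x n t\<bar>)"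
      by (intro conjunct2[OF Lp_dominated] abs_sum_Lp) (auto simp: sum_nonneg intro!: sum_abs)
    also have "\<dots> = (Lp_norm M p (\<lambda>t. \<Sum>n<N. \<bar>a n * x n t\<bar>) powr p) powr (1 / p)"
      using p by (simp add: powr_powr Lp_norm_nonneg)
    also have "\<dots> \<le> (4 * L\<^sup>2 * (\<Sum>n<N. \<bar>a n\<bar> powr p)) powr (1 / p)"
      unfolding L_def using p by (intro powr_mono2 abs_sum_le_lp K) auto
    also have "\<dots> = C * (\<Sum>n<N. \<bar>a n\<bar> powr p) powr (1 / p)"
      by (simp add: C_def powr_mult sum_nonneg)
    finally show ?thesis .
  qed
  \<comment> \<open>Enlarging \<open>C\<close> by \<open>1 / K\<close> ensures \<open>c \<le> C\<close>.\<close>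
  have "Lp_norm M p (\<lambda>t. \<Sum>n<N. a n * x n t) \<le> (C + 1 / K) * (\<Sum>n<N. \<bar>a n\<bar> powr p) powr (1 / p)"
    for N a
    using upper[of a N] K(1) by (simp add: distrib_right add_increasing2)
  with lower show ?thesis
    using K(1) by (intro exI[of _ "1 / K"] exI[of _ "C + 1 / K"]) (auto simp: C_def)
qed

end

theorem theorem2:
  fixes p :: real and x :: "nat \<Rightarrow> real \<Rightarrow> real"
  assumes "1 \<le> p"
    and "Lp_unconditionally_basic (lebesgue_on {0<..}) p x"
    and "\<And>n. Lp_norm (lebesgue_on {0<..}) p (x n) = 1"
    and "\<And>n. AE t in lebesgue_on {0<..}. 0 \<le> x n t"
  shows "\<exists>c C. 0 < c \<and> c \<le> C \<and>
    (\<forall>(N::nat) (a :: nat \<Rightarrow> real).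
       c * (\<Sum>n<N. \<bar>a n\<bar> powr p) powr (1 / p)
         \<le> Lp_norm (lebesgue_on {0<..}) p (\<lambda>t. \<Sum>n<N. a n * x n t) \<and>
       Lp_norm (lebesgue_on {0<..}) p (\<lambda>t. \<Sum>n<N. a n * x n t)
         \<le> C * (\<Sum>n<N. \<bar>a n\<bar> powr p) powr (1 / p))"
proof -
  interpret normalized_nonneg_unconditional_sequence "lebesgue_on {0<..}" p x
    using assms by unfold_locales
  show ?thesis
    by (rule equivalent_to_lp)
qed

end
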